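(* Consider the locally connected 4-cell downlink network described in the context, with block fading and network coherence bound $\tau_{\max}\ge 3$. Its (sum) DoF equals $8/3$, both with no CSIT and with perfect global CSIT, and both under the spatially i.i.d. fading assumption and without it (channels independent across links but not necessarily identically distributed).
   Context: There are four single-antenna transmitters (base stations) $A,B,C,D$ and eight single-antenna receivers $a_1,a_2,b_1,b_2,c_1,c_2,d_1,d_2$. There are eight independent messages $W_{a_1},W_{a_2}$ (originating at $A$), $W_{b_1},W_{b_2}$ (at $B$), $W_{c_1},W_{c_2}$ (at $C$), $W_{d_1},W_{d_2}$ (at $D$); receiver $x$ desires only $W_x$. Connectivity: $a_1$ and $b_1$ hear exactly $A$ and $B$; $a_2$ and $c_2$ hear exactly $A$ and $C$; $c_1$ and $d_1$ hear exactly $C$ and $D$; $b_2$ and $d_2$ hear exactly $B$ and $D$. At channel use $n$, receiver $r$ observes $Y_r(n)=\sum_t c_{rt}H_{rt}(n)X_t(n)+Z_r(n)$, where $c_{rt}\in\{0,1\}$ is this connectivity, $Z_r(n)$ is i.i.d. zero-mean unit-variance circularly symmetric complex Gaussian noise, and $E|X_t|^2\le P$. Channel coefficient magnitudes lie in a fixed interval bounded away from $0$ and $\infty$; channels are independent across links. Block fading: all channels are constant within blocks of a common length $\tau$ and drawn i.i.d. across blocks from a continuous distribution; $\tau$ is a fixed integer in $[1,\tau_{\max}]$ chosen by the code designer and known to all nodes. Spatially i.i.d. fading means the channel processes are also identically distributed across links. Each receiver knows the channel realizations from the transmitters it hears (local CSIR). No CSIT: transmitters know the connectivity and channel statistics (including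 $\tau$) but not the channel realizations. DoF = $\lim_{P\to\infty}$ of sum capacity divided by $\log P$. *)

theory Defs
  imports "HOL-Probability.Probability"
begin

datatype tx = A | B | C | D
datatype rx = a1 | a2 | b1 | b2 | c1 | c2 | d1 | d2

instance tx :: finite
proof
  have "UNIV \<subseteq> {A, B, C, D}" by (auto intro: tx.exhaust)
  then show "finite (UNIV :: tx set)" by (rule finite_subset) simp
qed

instance rx :: finite
proof
  have "UNIV \<subseteq> {a1, a2, b1, b2, c1, c2, d1, d2}" by (auto intro: rx.exhaust)
  then show "finite (UNIV :: rx set)" by (rule finite_subset) simp
qed

text \<open>Transmitter at which message W_r originates (receiver r desires W_r).\<close>
fun owner :: "rx \<Rightarrow> tx" where
  "owner a1 = A" | "owner a2 = A" | "owner b1 = B" | "owner b2 = B"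
| "owner c1 = C" | "owner c2 = C" | "owner d1 = D" | "owner d2 = D"

fun conn :: "rx \<Rightarrow> tx \<Rightarrow> bool" where
  "conn a1 t = (t = A \<or> t = B)" | "conn b1 t = (t = A \<or> t = B)"
| "conn a2 t = (t = A \<or> t = C)" | "conn c2 t = (t = A \<or> t = C)"
| "conn c1 t = (t = C \<or> t = D)" | "conn d1 t = (t = C \<or> t = D)"
| "conn b2 t = (t = B \<or> t = D)" | "conn d2 t = (t = B \<or> t = D)"

definition admissible_fading :: "(rx \<Rightarrow> tx \<Rightarrow> complex measure) \<Rightarrow> bool" where
  "admissible_fading \<mu> \<longleftrightarrow> (\<exists>hmin hmax. 0 < hmin \<and> hmin \<le> hmax \<and>
     (\<forall>r t. conn r t \<longrightarrow>
        prob_space (\<mu> r t) \<and> sets (\<mu> r t) = sets borel \<and>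
        absolutely_continuous lborel (\<mu> r t) \<and>
        (AE h in \<mu> r t. hmin \<le> cmod h \<and> cmod h \<le> hmax)))"

definition spatially_iid :: "(rx \<Rightarrow> tx \<Rightarrow> complex measure) \<Rightarrow> bool" where
  "spatially_iid \<mu> \<longleftrightarrow> (\<forall>r t r' t'. conn r t \<and> conn r' t' \<longrightarrow> \<mu> r t = \<mu> r' t')"

text \<open>Joint distribution of all link coefficients in one fading block: independent
  across links (unconnected links are irrelevant and set to 0).\<close>
definition linkM :: "(rx \<Rightarrow> tx \<Rightarrow> complex measure) \<Rightarrow> (rx \<times> tx \<Rightarrow> complex) measure" where
  "linkM \<mu> = PiM UNIV (\<lambda>(r, t). if conn r t then \<mu> r t else return borel 0)"

text \<open>Channel states of fading blocks 0,1,..,N-1 (i.i.d. across blocks); this covers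
  all blocks touched by N channel uses since tau >= 1.\<close>
definition chanM :: "(rx \<Rightarrow> tx \<Rightarrow> complex measure) \<Rightarrow> nat \<Rightarrow> (nat \<Rightarrow> rx \<times> tx \<Rightarrow> complex) measure" where
  "chanM \<mu> N = PiM {..<N} (\<lambda>_. linkM \<mu>)"

definition cgauss :: "complex measure" where
  "cgauss = density lborel (\<lambda>z. ennreal (exp (- (cmod z * cmod z)) / pi))"

definition noiseM :: "nat \<Rightarrow> (nat \<Rightarrow> rx \<Rightarrow> complex) measure" where
  "noiseM N = PiM {..<N} (\<lambda>_. PiM UNIV (\<lambda>_. cgauss))"

type_synonym chstate = "nat \<Rightarrow> rx \<times> tx \<Rightarrow> complex"
type_synonym encoder = "tx \<Rightarrow> nat \<Rightarrow> (rx \<Rightarrow> nat) \<Rightarrow> chstate \<Rightarrow> complex"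
type_synonym decoder = "rx \<Rightarrow> (nat \<Rightarrow> complex) \<Rightarrow> (nat \<Rightarrow> tx \<Rightarrow> complex) \<Rightarrow> nat"

definition msgs :: "(rx \<Rightarrow> nat) \<Rightarrow> (rx \<Rightarrow> nat) set" where
  "msgs M = {w. \<forall>r. w r < M r}"

definition rxsig :: "nat \<Rightarrow> encoder \<Rightarrow> (rx \<Rightarrow> nat) \<Rightarrow> chstate \<Rightarrow> (nat \<Rightarrow> rx \<Rightarrow> complex)
                      \<Rightarrow> rx \<Rightarrow> nat \<Rightarrow> complex" where
  "rxsig \<tau> enc w G Z r n =
     (\<Sum>t\<in>UNIV. if conn r t then G (n div \<tau>) (r, t) * enc t n w G else 0) + Z n r"

definition csir :: "nat \<Rightarrow> nat \<Rightarrow> chstate \<Rightarrow> rx \<Rightarrow> nat \<Rightarrow> tx \<Rightarrow> complex" where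
  "csir \<tau> N G r = restrict (\<lambda>n t. if conn r t then G (n div \<tau>) (r, t) else 0) {..<N}"

text \<open>Valid length-N code with message set sizes M. If csit = False (no CSIT) the
  transmitted symbols do not depend on the channel realizations; if csit = True
  (perfect global CSIT) they may depend on all channel coefficients up to the current
  channel use. Power constraint E|X_t(n)|^2 <= P, expectation over uniform messages
  and channels.\<close>
definition valid_code :: "(rx \<Rightarrow> tx \<Rightarrow> complex measure) \<Rightarrow> nat \<Rightarrow> bool \<Rightarrow> real \<Rightarrow> nat
     \<Rightarrow> (rx \<Rightarrow> nat) \<Rightarrow> encoder \<Rightarrow> decoder \<Rightarrow> bool" where
  "valid_code \<mu> \<tau> csit P N M enc dec \<longleftrightarrow>
     (\<forall>r. 1 \<le> M r) \<and>
     (\<forall>t n w w' G. (\<forall>r. owner r = t \<longrightarrow> w r = w' r) \<longrightarrow> enc t n w G = enc t n w' G) \<and>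
     (if csit then
        (\<forall>t n w G G'. (\<forall>k \<le> n div \<tau>. G k = G' k) \<longrightarrow> enc t n w G = enc t n w G') \<and>
        (\<forall>t n w. (\<lambda>G. enc t n w G) \<in> borel_measurable (chanM \<mu> N))
      else (\<forall>t n w G G'. enc t n w G = enc t n w G')) \<and>
     (\<forall>r. (\<lambda>(y, h). dec r y h) \<in> measurable
            (PiM {..<N} (\<lambda>_. borel) \<Otimes>\<^sub>M PiM {..<N} (\<lambda>_. PiM UNIV (\<lambda>_. borel)))
            (count_space UNIV)) \<and>
     (\<forall>t n. n < N \<longrightarrow>
        (\<Sum>w\<in>msgs M. \<integral>\<^sup>+ G. ennreal ((cmod (enc t n w G))^2) \<partial>chanM \<mu> N)
          \<le> ennreal P * of_nat (card (msgs M)))"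

definition errp :: "(rx \<Rightarrow> tx \<Rightarrow> complex measure) \<Rightarrow> nat \<Rightarrow> nat \<Rightarrow> (rx \<Rightarrow> nat)
     \<Rightarrow> encoder \<Rightarrow> decoder \<Rightarrow> ennreal" where
  "errp \<mu> \<tau> N M enc dec =
     (\<Sum>w\<in>msgs M. \<integral>\<^sup>+ G. \<integral>\<^sup>+ Z.
        (if \<exists>r. dec r (restrict (rxsig \<tau> enc w G Z r) {..<N}) (csir \<tau> N G r) \<noteq> w r
         then 1 else 0) \<partial>noiseM N \<partial>chanM \<mu> N)
     / of_nat (card (msgs M))"

text \<open>Achievable rate tuple (nats per channel use); the designer picks tau in [1,tau_max].\<close>
definition achievable :: "(rx \<Rightarrow> tx \<Rightarrow> complex measure) \<Rightarrow> nat \<Rightarrow> bool \<Rightarrow> real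
     \<Rightarrow> (rx \<Rightarrow> real) \<Rightarrow> bool" where
  "achievable \<mu> \<tau>max csit P R \<longleftrightarrow>
     (\<exists>\<tau>\<in>{1..\<tau>max}. \<forall>\<epsilon>>0. \<forall>N0. \<exists>N\<ge>N0. \<exists>M enc dec. 0 < N \<and>
        valid_code \<mu> \<tau> csit P N M enc dec \<and>
        (\<forall>r. R r - \<epsilon> \<le> ln (real (M r)) / real N) \<and>
        errp \<mu> \<tau> N M enc dec \<le> ennreal \<epsilon>)"

definition sum_capacity :: "(rx \<Rightarrow> tx \<Rightarrow> complex measure) \<Rightarrow> nat \<Rightarrow> bool \<Rightarrow> real \<Rightarrow> real" where
  "sum_capacity \<mu> \<tau>max csit P =
     Sup {(\<Sum>r\<in>UNIV. R r) | R. (\<forall>r. 0 \<le> R r) \<and> achievable \<mu> \<tau>max csit P R}"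

definition has_DoF :: "(rx \<Rightarrow> tx \<Rightarrow> complex measure) \<Rightarrow> nat \<Rightarrow> bool \<Rightarrow> real \<Rightarrow> bool" where
  "has_DoF \<mu> \<tau>max csit d \<longleftrightarrow>
     ((\<lambda>P. sum_capacity \<mu> \<tau>max csit P / ln P) \<longlongrightarrow> d) at_top"

end

theory Submission
  imports Defs "HOL-Real_Asymp.Real_Asymp"
begin

text \<open>
  Converse. Let receiver \<open>r1\<close> hear its own transmitter and the transmitter \<open>t\<close> of \<open>r2\<close> and \<open>r3\<close>.
  Once \<open>r1\<close> has decoded its message and is given all messages except those of \<open>r2\<close> and \<open>r3\<close>, it
  can subtract everything but the signal of \<open>t\<close> and so imitate \<open>r2\<close> and \<open>r3\<close> up to a bounded
  change of the noise. Hence the three rates add up to at most \<open>log P + O(1)\<close>, with or without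
  CSIT. Each rate occurs three times in the eight bounds of this kind, which gives \<open>8 / 3\<close>.
  Mutual information is avoided: the law of the channel is compared directly with a law under
  which all three decoders have to guess.

  Achievability. In a coherence block of length three every link is a constant scalar, so the
  beams of the eight streams can be chosen once and for all such that the interference at each
  receiver spans only two of the three dimensions: \<open>a2, b2\<close> use \<open>e0\<close>, \<open>a1, c1\<close> use \<open>e1\<close>,
  \<open>c2, d2\<close> use \<open>e2\<close>, and \<open>b1, d1\<close> use \<open>e0 + e1 + e2\<close>. Zero forcing leaves each receiver with
  one interference-free scalar channel use per block. On it a square constellation with fixed
  spacing makes symbol errors rare, independently of \<open>P\<close>, and an outer Gilbert-Varshamov code
  removes them at a negligible loss of rate, so every message attains \<open>1 / 3\<close>.
\<close>

section \<open>Gaussian noise\<close>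

text \<open>Splits the complex Gaussian weight over the two real coordinates, so that its integral
  becomes a product of one-dimensional integrals.\<close>

lemma exp_neg_norm_sq_complex: "exp (- (a * (cmod z * cmod z))) = (\<Prod>b\<in>Basis. exp (- (a * (z \<bullet> b)\<^sup>2)))"
proof -
  have "cmod z * cmod z = (Re z)\<^sup>2 + (Im z)\<^sup>2"
    by (simp add: cmod_def)
  then show ?thesis
    by (simp add: Basis_complex_def exp_add[symmetric] algebra_simps inner_complex_def)
qed

lemma nn_integral_gauss_real:
  assumes "0 < a"
  shows "(\<integral>\<^sup>+ x. ennreal (exp (- (a * x\<^sup>2))) \<partial>lborel) = ennreal (sqrt (pi / a))"
proof -
  \<comment> \<open>With this standard deviation the normal density is a multiple of the integrand,
    and total mass one gives the integral.\<close>
  define s where "s = sqrt (1 / (2 * a))"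
  have s: "0 < s" "2 * s\<^sup>2 = 1 / a"
    using assms by (simp_all add: s_def)
  interpret prob_space "density lborel (\<lambda>x. ennreal (normal_density 0 s x))"
    by (rule prob_space_normal_density) (use s in auto)
  have 1: "(\<integral>\<^sup>+ x. ennreal (normal_density 0 s x) \<partial>lborel) = 1"
    using emeasure_space_1 by (simp add: emeasure_density)
  have "exp (- (a * x\<^sup>2)) = sqrt (pi / a) * normal_density 0 s x" for x
  proof -
    have "sqrt (2 * pi * s\<^sup>2) = sqrt (pi / a)"
      using s(2) by (metis mult.commute mult.assoc times_divide_eq_right mult.right_neutral)
    moreover have "- (x\<^sup>2) / (2 * s\<^sup>2) = - (a * x\<^sup>2)"
      unfolding s(2) by simp
    moreover have "sqrt (pi / a) > 0" using assms by simp
    ultimately show ?thesis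
      using assms by (simp add: normal_density_def)
  qed
  then have "(\<integral>\<^sup>+ x. ennreal (exp (- (a * x\<^sup>2))) \<partial>lborel) =
      (\<integral>\<^sup>+ x. ennreal (sqrt (pi / a)) * ennreal (normal_density 0 s x) \<partial>lborel)"
    using assms by (simp add: ennreal_mult' normal_density_nonneg)
  then show ?thesis
    by (simp add: nn_integral_cmult 1)
qed

lemma nn_integral_gauss_complex:
  assumes "0 < a"
  shows "(\<integral>\<^sup>+ z. ennreal (exp (- (a * (cmod z * cmod z)))) \<partial>lborel) = ennreal (pi / a)"
proof -
  have "(\<integral>\<^sup>+ z. ennreal (exp (- (a * (cmod z * cmod z)))) \<partial>lborel) =
     (\<integral>\<^sup>+ z. (\<Prod>b\<in>Basis. ennreal (exp (- (a * (z \<bullet> b)\<^sup>2)))) \<partial>(lborel :: complex measure))"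
    by (intro nn_integral_cong) (simp add: exp_neg_norm_sq_complex prod_ennreal)
  also have "\<dots> = (\<Prod>b\<in>(Basis :: complex set). \<integral>\<^sup>+ x. ennreal (exp (- (a * x\<^sup>2))) \<partial>lborel)"
    by (rule nn_integral_lborel_prod) auto
  also have "\<dots> = ennreal (sqrt (pi / a)) ^ 2"
    by (simp add: nn_integral_gauss_real[OF assms] Basis_complex_def power2_eq_square[of "ennreal _"])
  also have "\<dots> = ennreal (pi / a)"
    using assms by (simp add: ennreal_power)
  finally show ?thesis .
qed

lemma sets_cgauss [measurable_cong, simp]: "sets cgauss = sets borel"
  by (simp add: cgauss_def)

lemma space_cgauss [simp]: "space cgauss = UNIV"
  by (simp add: cgauss_def)

lemma nn_integral_cgauss:
  assumes [measurable]: "g \<in> borel_measurable borel"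
  shows "(\<integral>\<^sup>+ z. g z \<partial>cgauss) = (\<integral>\<^sup>+ z. ennreal (exp (- (cmod z * cmod z)) / pi) * g z \<partial>lborel)"
  unfolding cgauss_def by (simp add: nn_integral_density)

lemma prob_space_cgauss: "prob_space cgauss"
proof
  have "emeasure cgauss UNIV = (\<integral>\<^sup>+ z. 1 \<partial>cgauss)" by simp
  also have "\<dots> = (\<integral>\<^sup>+ z. ennreal (1 / pi) * ennreal (exp (- (1 * (cmod z * cmod z)))) \<partial>lborel)"
    by (subst nn_integral_cgauss) (simp_all add: ennreal_mult' [symmetric])
  also have "\<dots> = ennreal (1 / pi) * ennreal (pi / 1)"
    by (subst nn_integral_cmult) (simp_all only: nn_integral_gauss_complex, auto)
  also have "\<dots> = 1"
    by (simp add: ennreal_mult'[symmetric])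
  finally show "emeasure cgauss (space cgauss) = 1" by simp
qed

text \<open>The exact value is 1; the cruder 4 only enters additive constants of the converse. It
  comes from \<open>t \<le> 2 * exp (t / 2)\<close>, which reduces the moment to the mass of a wider
  Gaussian.\<close>

lemma cgauss_second_moment: "(\<integral>\<^sup>+ z. ennreal ((cmod z)\<^sup>2) \<partial>cgauss) \<le> 4"
proof -
  have *: "exp (- (cmod z * cmod z)) / pi * (cmod z)\<^sup>2 \<le> 2 / pi * exp (- (1/2 * (cmod z * cmod z)))" for z
  proof -
    define t where "t = cmod z * cmod z"
    have "t / 2 \<le> exp (t / 2)"
      using exp_ge_add_one_self[of "t / 2"] by linarith
    then have "exp (- t) * t \<le> exp (- t) * (2 * exp (t / 2))"
      by (intro mult_left_mono) auto
    also have "\<dots> = 2 * exp (- (1/2 * t))"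
      by (simp add: exp_add[symmetric])
    finally show ?thesis
      by (simp add: t_def power2_eq_square divide_simps)
  qed
  have "(\<integral>\<^sup>+ z. ennreal ((cmod z)\<^sup>2) \<partial>cgauss) \<le>
      (\<integral>\<^sup>+ z. ennreal (2 / pi) * ennreal (exp (- (1/2 * (cmod z * cmod z)))) \<partial>lborel)"
    using * by (subst nn_integral_cgauss)
      (auto intro!: nn_integral_mono simp del: times_divide_eq_left times_divide_eq_right simp: ennreal_mult'[symmetric])
  also have "\<dots> = ennreal (2 / pi) * ennreal (pi / (1/2))"
    by (subst nn_integral_cmult) (simp_all only: nn_integral_gauss_complex, auto)
  also have "\<dots> = 4"
    by (simp add: ennreal_mult'[symmetric])
  finally show ?thesis .
qed

text \<open>For positive \<open>s\<close>, the Radon-Nikodym derivative with respect to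
  \<open>cgauss\<close> of the law of \<open>c + s u\<close>, where \<open>u\<close> is a standard
  complex Gaussian.\<close>

definition gauss_ratio :: "real \<Rightarrow> complex \<Rightarrow> complex \<Rightarrow> ennreal" where
  "gauss_ratio s c z = ennreal (exp ((cmod z)\<^sup>2 - (cmod (z - c))\<^sup>2 / s\<^sup>2) / s\<^sup>2)"

lemma measurable_gauss_ratio [measurable]:
  assumes [measurable]: "c \<in> borel_measurable M" "z \<in> borel_measurable M"
  shows "(\<lambda>x. gauss_ratio s (c x) (z x)) \<in> borel_measurable M"
  unfolding gauss_ratio_def by measurable

lemma cgauss_affine:
  assumes [measurable]: "g \<in> borel_measurable borel" and s: "0 < s"
  shows "(\<integral>\<^sup>+ z. g z * gauss_ratio s c z \<partial>cgauss) = (\<integral>\<^sup>+ u. g (c + s *\<^sub>R u) \<partial>cgauss)"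
proof -
  \<comment> \<open>Substitution \<open>x = c + s u\<close>; the Jacobian is \<open>s^2\<close>
    because the complex plane has real dimension two.\<close>
  have L: "(lborel :: complex measure) = density (distr lborel borel (\<lambda>x. c + s *\<^sub>R x)) (\<lambda>_. ennreal (s\<^sup>2))"
    using lborel_affine[of s c] s by simp
  have "(\<integral>\<^sup>+ z. g z * gauss_ratio s c z \<partial>cgauss) =
      (\<integral>\<^sup>+ z. ennreal (exp (- (cmod z * cmod z)) / pi) * (g z * gauss_ratio s c z) \<partial>lborel)"
    by (rule nn_integral_cgauss) measurable
  also have "\<dots> = (\<integral>\<^sup>+ u. ennreal (s\<^sup>2) * (ennreal (exp (- (cmod (c + s *\<^sub>R u) * cmod (c + s *\<^sub>R u))) / pi) *
       (g (c + s *\<^sub>R u) * gauss_ratio s c (c + s *\<^sub>R u))) \<partial>lborel)"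
    by (subst L, subst nn_integral_density) (simp_all add: nn_integral_distr)
  also have "\<dots> = (\<integral>\<^sup>+ u. ennreal (exp (- (cmod u * cmod u)) / pi) * g (c + s *\<^sub>R u) \<partial>lborel)"
  proof (intro nn_integral_cong)
    fix u :: complex
    have "(cmod (s *\<^sub>R u))\<^sup>2 / s\<^sup>2 = (cmod u)\<^sup>2"
      using s by (simp add: power_mult_distrib)
    then have "s\<^sup>2 * (exp (- (cmod (c + s *\<^sub>R u) * cmod (c + s *\<^sub>R u))) / pi *
        (exp ((cmod (c + s *\<^sub>R u))\<^sup>2 - (cmod (c + s *\<^sub>R u - c))\<^sup>2 / s\<^sup>2) / s\<^sup>2)) = exp (- (cmod u * cmod u)) / pi"
      using s by (simp add: power2_eq_square exp_add[symmetric])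
    then have "ennreal (s\<^sup>2) * (ennreal (exp (- (cmod (c + s *\<^sub>R u) * cmod (c + s *\<^sub>R u))) / pi) *
        gauss_ratio s c (c + s *\<^sub>R u)) = ennreal (exp (- (cmod u * cmod u)) / pi)"
      unfolding gauss_ratio_def by (simp add: ennreal_mult'[symmetric])
    moreover have "\<And>p q r t :: ennreal. p * (q * (r * t)) = (p * (q * t)) * r"
      by (simp only: mult_ac)
    ultimately show "ennreal (s\<^sup>2) * (ennreal (exp (- (cmod (c + s *\<^sub>R u) * cmod (c + s *\<^sub>R u))) / pi) *
       (g (c + s *\<^sub>R u) * gauss_ratio s c (c + s *\<^sub>R u))) =
       ennreal (exp (- (cmod u * cmod u)) / pi) * g (c + s *\<^sub>R u)"
      by simp
  qed
  also have "\<dots> = (\<integral>\<^sup>+ u. g (c + s *\<^sub>R u) \<partial>cgauss)"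
    by (rule nn_integral_cgauss[symmetric]) measurable
  finally show ?thesis .
qed

section \<open>Change of measure on product spaces\<close>

lemma product_prob_spaceI:
  assumes "\<And>i. prob_space (M i)"
  shows "product_prob_space M"
proof -
  interpret prob_space "M i" for i by (rule assms)
  show ?thesis by unfold_locales
qed

text \<open>The shift \<open>c\<close> does not look at coordinate \<open>i\<close>, so integrating
  that coordinate first leaves an affine substitution in one variable with a constant shift. Maps
  that move several coordinates are composed of such steps.\<close>

lemma PiM_cgauss_affine_coordinate:
  fixes g :: "('i::finite \<Rightarrow> complex) \<Rightarrow> ennreal"
  assumes [measurable]: "g \<in> borel_measurable (PiM UNIV (\<lambda>_. cgauss))"
    "c \<in> borel_measurable (PiM UNIV (\<lambda>_. cgauss))"
    and c: "\<And>x y. c (x(i := y)) = c x" and s: "0 < s"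
  shows "(\<integral>\<^sup>+ x. g x * gauss_ratio s (c x) (x i) \<partial>PiM UNIV (\<lambda>_. cgauss)) =
         (\<integral>\<^sup>+ x. g (x(i := c x + s *\<^sub>R x i)) \<partial>PiM UNIV (\<lambda>_. cgauss))"
proof -
  interpret P: product_prob_space "\<lambda>_::'i. cgauss"
    by (intro product_prob_spaceI prob_space_cgauss)
  let ?J = "UNIV - {i}"
  have U: "UNIV = insert i ?J" by auto
  have E: "PiM UNIV (\<lambda>_. cgauss) = PiM (insert i ?J) (\<lambda>_. cgauss)" using U by simp
  have [measurable]: "g \<in> borel_measurable (PiM (insert i ?J) (\<lambda>_. cgauss))"
     "c \<in> borel_measurable (PiM (insert i ?J) (\<lambda>_. cgauss))"
    using assms U by simp_all
  have upd: "(\<lambda>y. x(i := y)) \<in> measurable cgauss (PiM (insert i ?J) (\<lambda>_. cgauss))"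
    if "x \<in> space (PiM ?J (\<lambda>_. cgauss))" for x
    using measurable_component_update[OF that, of i] by simp
  have upd2: "(\<lambda>x. x(i := c x + s *\<^sub>R x i)) \<in> measurable (PiM (insert i ?J) (\<lambda>_. cgauss)) (PiM (insert i ?J) (\<lambda>_. cgauss))"
    by (rule measurable_fun_upd[where J="insert i ?J"]) auto
  have gu: "(\<lambda>x. g (x(i := c x + s *\<^sub>R x i))) \<in> borel_measurable (PiM UNIV (\<lambda>_. cgauss))"
    using measurable_compose[OF upd2, of g borel] U by simp
  have "(\<integral>\<^sup>+ x. g x * gauss_ratio s (c x) (x i) \<partial>PiM UNIV (\<lambda>_. cgauss)) =
     (\<integral>\<^sup>+ x. \<integral>\<^sup>+ y. g (x(i := y)) * gauss_ratio s (c (x(i := y))) ((x(i := y)) i) \<partial>cgauss \<partial>PiM ?J (\<lambda>_. cgauss))"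
    unfolding E by (subst P.product_nn_integral_insert) auto
  also have "\<dots> = (\<integral>\<^sup>+ x. \<integral>\<^sup>+ y. g (x(i := c x + s *\<^sub>R y)) \<partial>cgauss \<partial>PiM ?J (\<lambda>_. cgauss))"
  proof (rule nn_integral_cong)
    fix x assume x: "x \<in> space (PiM ?J (\<lambda>_. cgauss))"
    have "(\<lambda>y. g (x(i := y))) \<in> borel_measurable borel"
      using measurable_compose[OF upd[OF x], of g borel] by (simp add: measurable_cong_sets[OF sets_cgauss refl])
    from cgauss_affine[OF this s, of "c x"]
    show "(\<integral>\<^sup>+ y. g (x(i := y)) * gauss_ratio s (c (x(i := y))) ((x(i := y)) i) \<partial>cgauss) =
       (\<integral>\<^sup>+ y. g (x(i := c x + s *\<^sub>R y)) \<partial>cgauss)"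
      by (simp add: c)
  qed
  also have "\<dots> = (\<integral>\<^sup>+ x. g (x(i := c x + s *\<^sub>R x i)) \<partial>PiM (insert i ?J) (\<lambda>_. cgauss))"
    by (subst P.product_nn_integral_insert) (auto simp: c gu)
  finally show ?thesis by (simp add: U[symmetric])
qed

text \<open>Both the density and the indicator of a box factor over the coordinates. Boxes suffice
  to identify a product measure.\<close>

lemma emeasure_density_PiM_cube:
  assumes I: "finite I" and P: "prob_space P"
    and W: "\<And>i. i \<in> I \<Longrightarrow> W i \<in> borel_measurable P"
    and S: "\<And>i. i \<in> I \<Longrightarrow> S i \<in> sets P"
  shows "emeasure (density (PiM I (\<lambda>_. P)) (\<lambda>x. \<Prod>i\<in>I. W i (x i))) (Pi\<^sub>E I S) =
         (\<Prod>i\<in>I. emeasure (density P (W i)) (S i))"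
proof -
  interpret P: product_prob_space "\<lambda>_. P"
    by (intro product_prob_spaceI P)
  have WI: "(\<lambda>x. W i (x i)) \<in> borel_measurable (PiM I (\<lambda>_. P))" if "i \<in> I" for i
    by (rule measurable_compose[OF _ W[OF that]]) (auto intro: measurable_component_singleton that)
  have "emeasure (density (PiM I (\<lambda>_. P)) (\<lambda>x. \<Prod>i\<in>I. W i (x i))) (Pi\<^sub>E I S) =
     (\<integral>\<^sup>+ x. (\<Prod>i\<in>I. W i (x i)) * indicator (Pi\<^sub>E I S) x \<partial>PiM I (\<lambda>_. P))"
    by (rule emeasure_density) (auto intro!: sets_PiM_I_finite I S borel_measurable_prod_ennreal WI)
  also have "\<dots> = (\<integral>\<^sup>+ x. (\<Prod>i\<in>I. W i (x i) * indicator (S i) (x i)) \<partial>PiM I (\<lambda>_. P))"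
  proof (intro nn_integral_cong)
    fix x assume "x \<in> space (PiM I (\<lambda>_. P))"
    then have "x \<in> extensional I" by (auto simp: space_PiM PiE_def)
    then have "indicator (Pi\<^sub>E I S) x = (\<Prod>i\<in>I. indicator (S i) (x i) :: ennreal)"
      using I by (auto simp: indicator_def PiE_def Pi_def prod_zero_iff)
    then show "(\<Prod>i\<in>I. W i (x i)) * indicator (Pi\<^sub>E I S) x = (\<Prod>i\<in>I. W i (x i) * indicator (S i) (x i))"
      by (simp add: prod.distrib)
  qed
  also have "\<dots> = (\<Prod>i\<in>I. \<integral>\<^sup>+ x. W i x * indicator (S i) x \<partial>P)"
    by (rule P.product_nn_integral_prod) (auto intro!: I W S borel_measurable_times_ennreal borel_measurable_indicator)
  also have "\<dots> = (\<Prod>i\<in>I. emeasure (density P (W i)) (S i))"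
    by (intro prod.cong refl) (simp add: emeasure_density W S)
  finally show ?thesis .
qed

text \<open>The product density and the image measure both agree with \<open>PiM I DD\<close> on
  boxes, hence are equal. This carries the tilt of one channel use to \<open>N\<close> uses, with
  parameters that vary from use to use.\<close>

lemma nn_integral_PiM_transport:
  assumes I: "finite I" and P: "prob_space P"
    and W: "\<And>i. i \<in> I \<Longrightarrow> W i \<in> borel_measurable P"
    and T: "\<And>i. i \<in> I \<Longrightarrow> T i \<in> measurable P P"
    and eq: "\<And>i. i \<in> I \<Longrightarrow> distr P P (T i) = density P (W i)"
    and g [measurable]: "g \<in> borel_measurable (PiM I (\<lambda>_. P))"
  shows "(\<integral>\<^sup>+ x. g x * (\<Prod>i\<in>I. W i (x i)) \<partial>PiM I (\<lambda>_. P)) =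
         (\<integral>\<^sup>+ x. g (\<lambda>i\<in>I. T i (x i)) \<partial>PiM I (\<lambda>_. P))"
proof -
  interpret P: product_prob_space "\<lambda>_. P"
    by (intro product_prob_spaceI P)
  \<comment> \<open>The product locale wants a probability measure at every index, hence the default
    \<open>P\<close> outside \<open>I\<close>.\<close>
  define DD where "DD i = (if i \<in> I then distr P P (T i) else P)" for i
  have "prob_space (DD i)" for i
    unfolding DD_def using prob_space.prob_space_distr[OF P] T P by auto
  then interpret D: product_prob_space DD
    by (rule product_prob_spaceI)
  have sD: "sets (DD i) = sets P" for i by (simp add: DD_def)
  have sP: "sets (PiM I DD) = sets (PiM I (\<lambda>_. P))"
    by (intro sets_PiM_cong) (simp_all add: sD)
  have WI: "(\<lambda>x. W i (x i)) \<in> borel_measurable (PiM I (\<lambda>_. P))" if "i \<in> I" for i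
    by (rule measurable_compose[OF _ W[OF that]]) (auto intro: measurable_component_singleton that)
  have TI: "(\<lambda>x. T i (x i)) \<in> measurable (PiM I (\<lambda>_. P)) P" if "i \<in> I" for i
    by (rule measurable_compose[OF _ T[OF that]]) (auto intro: measurable_component_singleton that)
  let ?TT = "\<lambda>x. \<lambda>i\<in>I. T i (x i)"
  have TT [measurable]: "?TT \<in> measurable (PiM I (\<lambda>_. P)) (PiM I (\<lambda>_. P))"
    by (intro measurable_restrict TI)
  have WW [measurable]: "(\<lambda>x. \<Prod>i\<in>I. W i (x i)) \<in> borel_measurable (PiM I (\<lambda>_. P))"
    by (intro borel_measurable_prod_ennreal WI)
  have 1: "density (PiM I (\<lambda>_. P)) (\<lambda>x. \<Prod>i\<in>I. W i (x i)) = PiM I DD"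
  proof (rule D.PiM_eqI)
    fix S assume S: "\<And>i. i \<in> I \<Longrightarrow> S i \<in> sets (DD i)"
    then show "emeasure (density (PiM I (\<lambda>_. P)) (\<lambda>x. \<Prod>i\<in>I. W i (x i))) (Pi\<^sub>E I S) = (\<Prod>i\<in>I. emeasure (DD i) (S i))"
      by (subst emeasure_density_PiM_cube[OF I P W]) (auto simp: sD DD_def eq)
  qed (use sP I in auto)
  have 2: "distr (PiM I (\<lambda>_. P)) (PiM I (\<lambda>_. P)) ?TT = PiM I DD"
  proof (rule D.PiM_eqI)
    fix S assume S: "\<And>i. i \<in> I \<Longrightarrow> S i \<in> sets (DD i)"
    then have S': "\<And>i. i \<in> I \<Longrightarrow> S i \<in> sets P" by (simp add: sD)
    have "emeasure (distr (PiM I (\<lambda>_. P)) (PiM I (\<lambda>_. P)) ?TT) (Pi\<^sub>E I S) =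
       emeasure (PiM I (\<lambda>_. P)) (?TT -` Pi\<^sub>E I S \<inter> space (PiM I (\<lambda>_. P)))"
      by (rule emeasure_distr) (auto intro!: sets_PiM_I_finite I S')
    also have "?TT -` Pi\<^sub>E I S \<inter> space (PiM I (\<lambda>_. P)) = Pi\<^sub>E I (\<lambda>i. T i -` S i \<inter> space P)"
      by (auto simp: space_PiM PiE_iff Pi_iff)
    also have "emeasure (PiM I (\<lambda>_. P)) \<dots> = (\<Prod>i\<in>I. emeasure P (T i -` S i \<inter> space P))"
      by (intro P.emeasure_PiM I measurable_sets[OF T S'])
    also have "\<dots> = (\<Prod>i\<in>I. emeasure (DD i) (S i))"
      by (intro prod.cong refl) (simp add: DD_def emeasure_distr T S')
    finally show "emeasure (distr (PiM I (\<lambda>_. P)) (PiM I (\<lambda>_. P)) ?TT) (Pi\<^sub>E I S) = (\<Prod>i\<in>I. emeasure (DD i) (S i))" .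
  qed (use sP I in auto)
  have "(\<integral>\<^sup>+ x. g x * (\<Prod>i\<in>I. W i (x i)) \<partial>PiM I (\<lambda>_. P)) =
     (\<integral>\<^sup>+ x. g x \<partial>density (PiM I (\<lambda>_. P)) (\<lambda>x. \<Prod>i\<in>I. W i (x i)))"
    by (subst nn_integral_density) (simp_all add: mult.commute)
  also have "\<dots> = (\<integral>\<^sup>+ x. g x \<partial>distr (PiM I (\<lambda>_. P)) (PiM I (\<lambda>_. P)) ?TT)"
    by (simp add: 1 2)
  also have "\<dots> = (\<integral>\<^sup>+ x. g (?TT x) \<partial>PiM I (\<lambda>_. P))"
    by (rule nn_integral_distr) measurable
  finally show ?thesis .
qed

section \<open>The tilted noise law of one channel use\<close>

abbreviation rx_noise :: "(rx \<Rightarrow> complex) measure" where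
  "rx_noise \<equiv> PiM UNIV (\<lambda>_. cgauss)"

lemma prob_space_rx_noise: "prob_space rx_noise"
  by (intro prob_space_PiM prob_space_cgauss)

lemma prob_space_noiseM: "prob_space (noiseM N)"
  unfolding noiseM_def by (intro prob_space_PiM prob_space_cgauss)

text \<open>Law of the noise under which the first receiver observes \<open>s\<close> times a standard
  Gaussian, whatever the mean \<open>m\<close> of its signal is, and the noise of the other two
  receivers is correlated with that of the first.\<close>

definition tilt_map ::
    "real \<Rightarrow> complex \<Rightarrow> complex \<Rightarrow> complex \<Rightarrow> rx \<Rightarrow> rx \<Rightarrow> rx \<Rightarrow> (rx \<Rightarrow> complex) \<Rightarrow> rx \<Rightarrow> complex" where
  "tilt_map s m b b' r1 r2 r3 u =
     (let z = s *\<^sub>R u r1 - m in u(r1 := z, r2 := b * z + u r2, r3 := b' * z + u r3))"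

definition tilt_density ::
    "real \<Rightarrow> complex \<Rightarrow> complex \<Rightarrow> complex \<Rightarrow> rx \<Rightarrow> rx \<Rightarrow> rx \<Rightarrow> (rx \<Rightarrow> complex) \<Rightarrow> ennreal" where
  "tilt_density s m b b' r1 r2 r3 z =
     gauss_ratio s (- m) (z r1) * gauss_ratio 1 (b * z r1) (z r2) * gauss_ratio 1 (b' * z r1) (z r3)"

lemma measurable_rx_component [measurable]: "(\<lambda>z. z r) \<in> borel_measurable rx_noise"
  using measurable_component_singleton[of r UNIV "\<lambda>_. cgauss"] by (simp add: measurable_cong_sets[OF refl sets_cgauss])

lemma measurable_tilt_density [measurable]: "tilt_density s m b b' r1 r2 r3 \<in> borel_measurable rx_noise"
  unfolding tilt_density_def[abs_def] by measurable

lemma measurable_into_rx_noise: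
  assumes "\<And>r. (\<lambda>x. f x r) \<in> borel_measurable M"
  shows "f \<in> measurable M rx_noise"
  by (rule measurable_PiM_single') (use assms in \<open>auto simp: space_PiM measurable_cong_sets[OF refl sets_cgauss]\<close>)

lemma measurable_rx_update [measurable]:
  assumes "f \<in> borel_measurable rx_noise"
  shows "(\<lambda>x. x(r := f x)) \<in> measurable rx_noise rx_noise"
  by (rule measurable_into_rx_noise) (use assms in \<open>auto simp: fun_upd_def\<close>)

lemma measurable_tilt_map [measurable]: "tilt_map s m b b' r1 r2 r3 \<in> measurable rx_noise rx_noise"
  unfolding tilt_map_def[abs_def] Let_def by (rule measurable_into_rx_noise) (auto simp: fun_upd_def)

text \<open>The tilt is triangular: the new noise of \<open>r2\<close> and \<open>r3\<close> is
  shifted by multiples of that of \<open>r1\<close>. The three density factors are therefore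
  absorbed one coordinate at a time, with \<open>r1\<close> last, while the shifts of the other two
  are still expressed through it.\<close>

lemma distr_tilt_map:
  assumes d: "r1 \<noteq> r2" "r1 \<noteq> r3" "r2 \<noteq> r3" and s: "0 < s"
  shows "distr rx_noise rx_noise (tilt_map s m b b' r1 r2 r3) =
         density rx_noise (tilt_density s m b b' r1 r2 r3)"
proof (rule measure_eqI)
  fix S assume "S \<in> sets (distr rx_noise rx_noise (tilt_map s m b b' r1 r2 r3))"
  then have S [measurable]: "S \<in> sets rx_noise" by simp
  define g :: "(rx \<Rightarrow> complex) \<Rightarrow> ennreal" where "g = indicator S"
  have g [measurable]: "g \<in> borel_measurable rx_noise" by (simp add: g_def)
  have [measurable]: "(\<lambda>x. g (x(r2 := b * x r1 + x r2, r3 := b' * x r1 + x r3))) \<in> borel_measurable rx_noise"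
    by (rule measurable_compose[OF measurable_into_rx_noise g]) (auto simp: fun_upd_def)
  let ?c2 = "\<lambda>x. b * x r1" and ?c3 = "\<lambda>x. b' * x r1"
  let ?r1 = "\<lambda>x. gauss_ratio s (- m) (x r1)"
  let ?r2 = "\<lambda>x. gauss_ratio 1 (b * x r1) (x r2)"
  have "emeasure (density rx_noise (tilt_density s m b b' r1 r2 r3)) S =
     (\<integral>\<^sup>+ x. (g x * ?r1 x * ?r2 x) * gauss_ratio 1 (?c3 x) (x r3) \<partial>rx_noise)"
    by (subst emeasure_density) (simp_all add: g_def tilt_density_def mult_ac)
  also have "\<dots> = (\<integral>\<^sup>+ x. g (x(r3 := ?c3 x + 1 *\<^sub>R x r3)) * ?r1 x * ?r2 x \<partial>rx_noise)"
    using d by (subst PiM_cgauss_affine_coordinate) auto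
  also have "\<dots> = (\<integral>\<^sup>+ x. g (x(r2 := ?c2 x + 1 *\<^sub>R x r2, r3 := ?c3 x + 1 *\<^sub>R x r3)) * ?r1 x \<partial>rx_noise)"
    using d by (subst PiM_cgauss_affine_coordinate) auto
  also have "\<dots> = (\<integral>\<^sup>+ x. g (tilt_map s m b b' r1 r2 r3 x) \<partial>rx_noise)"
    using d s by (subst PiM_cgauss_affine_coordinate) (auto simp: tilt_map_def Let_def)
  also have "\<dots> = (\<integral>\<^sup>+ x. g x \<partial>distr rx_noise rx_noise (tilt_map s m b b' r1 r2 r3))"
    by (rule nn_integral_distr[symmetric]) measurable
  also have "\<dots> = emeasure (distr rx_noise rx_noise (tilt_map s m b b' r1 r2 r3)) S"
    by (simp add: g_def)
  finally show "emeasure (distr rx_noise rx_noise (tilt_map s m b b' r1 r2 r3)) S =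
    emeasure (density rx_noise (tilt_density s m b b' r1 r2 r3)) S" by simp
qed simp

text \<open>Deliberately crude: without cross terms only second moments of the noise matter later.\<close>

lemma exp_neg_le_gauss_ratio:
  assumes "1 \<le> s"
  shows "ennreal (exp (- (2 * ln s + 2 * (cmod c)\<^sup>2 / s\<^sup>2 + 2 * (cmod z)\<^sup>2))) \<le> gauss_ratio s c z"
proof -
  have "(cmod (z - c))\<^sup>2 \<le> (cmod z + cmod c)\<^sup>2"
    by (intro power_mono norm_triangle_ineq4) auto
  also have "\<dots> \<le> 2 * (cmod z)\<^sup>2 + 2 * (cmod c)\<^sup>2"
    using sum_squares_bound[of "cmod z" "cmod c"] by (simp add: power2_sum)
  finally have "(cmod (z - c))\<^sup>2 / s\<^sup>2 \<le> (2 * (cmod z)\<^sup>2 + 2 * (cmod c)\<^sup>2) / s\<^sup>2"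
    by (intro divide_right_mono) auto
  also have "\<dots> \<le> 2 * (cmod z)\<^sup>2 + 2 * (cmod c)\<^sup>2 / s\<^sup>2"
  proof -
    have "1 \<le> s\<^sup>2" using assms by (simp add: one_le_power)
    then have "2 * (cmod z)\<^sup>2 / s\<^sup>2 \<le> 2 * (cmod z)\<^sup>2 / 1"
      by (intro divide_left_mono) auto
    then show ?thesis by (simp add: add_divide_distrib)
  qed
  finally have le: "- (2 * ln s + 2 * (cmod c)\<^sup>2 / s\<^sup>2 + 2 * (cmod z)\<^sup>2) \<le>
      ((cmod z)\<^sup>2 - (cmod (z - c))\<^sup>2 / s\<^sup>2) - 2 * ln s"
    using zero_le_power2[of "cmod z"] by linarith
  have "exp (2 * ln s) = s\<^sup>2"
    using assms by (simp add: exp_double)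
  then have "exp (((cmod z)\<^sup>2 - (cmod (z - c))\<^sup>2 / s\<^sup>2) - 2 * ln s) =
      exp ((cmod z)\<^sup>2 - (cmod (z - c))\<^sup>2 / s\<^sup>2) / s\<^sup>2"
    by (simp add: exp_diff)
  with le show ?thesis
    unfolding gauss_ratio_def by (metis ennreal_leI exp_le_cancel_iff)
qed

lemma measurable_noise_use [measurable]: "n < N \<Longrightarrow> (\<lambda>Z. Z n) \<in> measurable (noiseM N) rx_noise"
  unfolding noiseM_def by (rule measurable_component_singleton) auto

lemma measurable_noise_component [measurable]:
  "n < N \<Longrightarrow> (\<lambda>Z. Z n r) \<in> borel_measurable (noiseM N)"
  by (rule measurable_compose[OF measurable_noise_use measurable_rx_component])

section \<open>Channel states and codes\<close>

lemma conn_owner [simp]: "conn r (owner r)"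
  by (cases r) auto

locale fading_channel =
  fixes \<mu> :: "rx \<Rightarrow> tx \<Rightarrow> complex measure" and hmin hmax :: real
  assumes hmin: "0 < hmin" and hmin_le_hmax: "hmin \<le> hmax"
    and link_prob: "conn r t \<Longrightarrow> prob_space (\<mu> r t)"
    and link_sets: "conn r t \<Longrightarrow> sets (\<mu> r t) = sets borel"
    and link_AE: "conn r t \<Longrightarrow> AE h in \<mu> r t. hmin \<le> cmod h \<and> cmod h \<le> hmax"

lemma admissible_fading_channel:
  "admissible_fading \<mu> \<Longrightarrow> \<exists>hmin hmax. fading_channel \<mu> hmin hmax"
  unfolding admissible_fading_def fading_channel_def by blast

context fading_channel
begin

lemma hmax: "0 < hmax"
  using hmin hmin_le_hmax by linarith

lemma prob_space_link: "prob_space (case p of (r, t) \<Rightarrow> if conn r t then \<mu> r t else return borel 0)"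
  by (auto simp: link_prob intro!: prob_space_return split: prod.splits)

lemma prob_space_linkM: "prob_space (linkM \<mu>)"
  unfolding linkM_def by (intro prob_space_PiM prob_space_link)

lemma prob_space_chanM: "prob_space (chanM \<mu> N)"
  unfolding chanM_def by (intro prob_space_PiM prob_space_linkM)

lemma measurable_link_component:
  assumes "conn r t"
  shows "(\<lambda>g. g (r, t)) \<in> borel_measurable (linkM \<mu>)"
proof -
  have "(\<lambda>g. g (r, t)) \<in> measurable (linkM \<mu>) (if conn r t then \<mu> r t else return borel 0)"
    unfolding linkM_def using measurable_component_singleton[of "(r, t)" UNIV
      "\<lambda>(r, t). if conn r t then \<mu> r t else return borel 0"] by simp
  then show ?thesis
    using assms by (simp add: measurable_cong_sets[OF refl link_sets])
qed

lemma measurable_chan_component [measurable]: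
  assumes "n < N" "conn r t"
  shows "(\<lambda>G. G n (r, t)) \<in> borel_measurable (chanM \<mu> N)"
proof -
  have "(\<lambda>G. G n) \<in> measurable (chanM \<mu> N) (linkM \<mu>)"
    unfolding chanM_def using assms by (intro measurable_component_singleton) auto
  from measurable_compose[OF this measurable_link_component[OF assms(2)]] show ?thesis .
qed

lemma AE_chan_range:
  "AE G in chanM \<mu> N. \<forall>n r t. n < N \<longrightarrow> conn r t \<longrightarrow> hmin \<le> cmod (G n (r, t)) \<and> cmod (G n (r, t)) \<le> hmax"
proof -
  have link: "AE g in linkM \<mu>. hmin \<le> cmod (g (r, t)) \<and> cmod (g (r, t)) \<le> hmax" if "conn r t" for r t
    unfolding linkM_def
  proof (rule AE_PiM_component[where i="(r, t)" and P="\<lambda>h. hmin \<le> cmod h \<and> cmod h \<le> hmax"])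
    show "prob_space (case p of (r, t) \<Rightarrow> if conn r t then \<mu> r t else return borel 0)" for p
      by (rule prob_space_link)
  qed (use that link_AE in auto)
  have "AE G in chanM \<mu> N. n < N \<longrightarrow> conn r t \<longrightarrow> hmin \<le> cmod (G n (r, t)) \<and> cmod (G n (r, t)) \<le> hmax" for n r t
  proof (cases "n < N \<and> conn r t")
    case True
    have "AE G in PiM {..<N} (\<lambda>_. linkM \<mu>). hmin \<le> cmod (G n (r, t)) \<and> cmod (G n (r, t)) \<le> hmax"
      by (rule AE_PiM_component[where i=n and P="\<lambda>g. hmin \<le> cmod (g (r, t)) \<and> cmod (g (r, t)) \<le> hmax"])
         (use True link prob_space_linkM in auto)
    then show ?thesis unfolding chanM_def using True by simp
  qed auto
  then show ?thesis by (simp add: AE_all_countable)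
qed

section \<open>Measurability of encoders, decoders and the error event\<close>

lemma measurable_encoder:
  assumes "valid_code \<mu> \<tau> csit P N M enc dec"
  shows "(\<lambda>G. enc t n w G) \<in> borel_measurable (chanM \<mu> N)"
proof (cases csit)
  case True
  with assms show ?thesis by (simp add: valid_code_def)
next
  case False
  define k where "k = enc t n w undefined"
  have "enc t n w G = k" for G
    using assms False unfolding valid_code_def k_def by presburger
  then show ?thesis by simp
qed

lemma csir_in_space: "csir \<tau> N G r \<in> space (PiM {..<N} (\<lambda>_. PiM UNIV (\<lambda>_. borel)))"
  by (simp add: csir_def space_PiM)

lemma measurable_decoder_fixed:
  assumes "(\<lambda>(y, h). dec y h) \<in> measurable (PiM {..<N} (\<lambda>_. borel) \<Otimes>\<^sub>M PiM {..<N} (\<lambda>_. PiM UNIV (\<lambda>_. borel))) (count_space UNIV)"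
  shows "(\<lambda>y. dec y (csir \<tau> N G r)) \<in> measurable (PiM {..<N} (\<lambda>_. borel)) (count_space UNIV)"
  using measurable_compose[OF measurable_Pair2'[OF csir_in_space] assms] by simp

lemma measurable_error_event:
  assumes valid: "valid_code \<mu> \<tau> csit P N M enc dec" and \<tau>: "1 \<le> \<tau>"
  shows "(\<lambda>(G, Z). if \<exists>r. dec r (restrict (rxsig \<tau> enc w G Z r) {..<N}) (csir \<tau> N G r) \<noteq> w r
           then 1 else 0 :: ennreal) \<in> borel_measurable (chanM \<mu> N \<Otimes>\<^sub>M noiseM N)"
proof -
  \<comment> \<open>A channel use has an index at least that of its block, so \<open>N\<close>
    blocks of channel states cover all \<open>N\<close> uses.\<close>
  have div: "n div \<tau> < N" if "n < N" for n
    using that div_le_dividend[of n \<tau>] by linarith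
  have E [measurable]: "(\<lambda>G. enc t n w G) \<in> borel_measurable (chanM \<mu> N)" for t n
    by (rule measurable_encoder[OF valid])
  have y: "(\<lambda>p. restrict (rxsig \<tau> enc w (fst p) (snd p) r) {..<N}) \<in>
      measurable (chanM \<mu> N \<Otimes>\<^sub>M noiseM N) (PiM {..<N} (\<lambda>_. borel))" for r
  proof (rule measurable_restrict)
    fix n assume n: "n \<in> {..<N}"
    have [measurable]: "(\<lambda>p. if conn r t then fst p (n div \<tau>) (r, t) * enc t n w (fst p) else 0)
        \<in> borel_measurable (chanM \<mu> N \<Otimes>\<^sub>M noiseM N)" for t
      using n div[of n] measurable_compose[OF measurable_fst measurable_chan_component[of "n div \<tau>" N r t]]
        measurable_compose[OF measurable_fst E[of t n]]
      by (cases "conn r t") auto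
    show "(\<lambda>p. rxsig \<tau> enc w (fst p) (snd p) r n) \<in> borel_measurable (chanM \<mu> N \<Otimes>\<^sub>M noiseM N)"
      unfolding rxsig_def using n measurable_compose[OF measurable_snd measurable_noise_component[of n N r]] by auto
  qed
  have h: "(\<lambda>p. csir \<tau> N (fst p) r) \<in>
      measurable (chanM \<mu> N \<Otimes>\<^sub>M noiseM N) (PiM {..<N} (\<lambda>_. PiM UNIV (\<lambda>_. borel)))" for r
    unfolding csir_def
  proof (rule measurable_restrict)
    fix n assume n: "n \<in> {..<N}"
    have "(\<lambda>p. if conn r t then fst p (n div \<tau>) (r, t) else 0)
        \<in> borel_measurable (chanM \<mu> N \<Otimes>\<^sub>M noiseM N)" for t
      using n div[of n] measurable_compose[OF measurable_fst measurable_chan_component[of "n div \<tau>" N r t]]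
      by (cases "conn r t") auto
    then show "(\<lambda>p t. if conn r t then fst p (n div \<tau>) (r, t) else 0)
        \<in> measurable (chanM \<mu> N \<Otimes>\<^sub>M noiseM N) (PiM UNIV (\<lambda>_. borel))"
      by (intro measurable_PiM_single') auto
  qed
  have [measurable]: "(\<lambda>p. dec r (restrict (rxsig \<tau> enc w (fst p) (snd p) r) {..<N}) (csir \<tau> N (fst p) r)) \<in>
      measurable (chanM \<mu> N \<Otimes>\<^sub>M noiseM N) (count_space UNIV)" for r
  proof -
    have "(\<lambda>(y, h). dec r y h) \<in> measurable (PiM {..<N} (\<lambda>_. borel) \<Otimes>\<^sub>M PiM {..<N} (\<lambda>_. PiM UNIV (\<lambda>_. borel))) (count_space UNIV)"
      using valid by (simp add: valid_code_def)
    from measurable_compose[OF measurable_Pair[OF y h] this] show ?thesis by simp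
  qed
  show ?thesis unfolding split_beta' by measurable
qed

end

lemma msgs_eq_PiE: "msgs M = (\<Pi>\<^sub>E r\<in>UNIV. {..<M r})"
  by (auto simp: msgs_def PiE_def Pi_def)

lemma finite_msgs [simp]: "finite (msgs M)"
  unfolding msgs_eq_PiE by (intro finite_PiE) auto

lemma card_msgs_pos:
  assumes "\<And>r. 1 \<le> M r"
  shows "0 < card (msgs M)"
proof -
  have "0 < M r" for r using assms[of r] by linarith
  then have "(\<lambda>_. 0) \<in> msgs M" by (simp add: msgs_def)
  then show ?thesis by (auto simp: card_gt_0_iff)
qed

section \<open>Converse\<close>

text \<open>A member of \<open>S\<close> is fixed by its five other coordinates, so overwriting the
  three chosen ones by arbitrary messages is injective. Read as a probability, guessing all three
  messages succeeds for at most one message tuple in \<open>M r1 * M r2 * M r3\<close>.\<close>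

lemma card_determined_msgs:
  assumes S: "S \<subseteq> msgs M" and d: "r1 \<noteq> r2" "r1 \<noteq> r3" "r2 \<noteq> r3"
    and det: "\<And>w w'. w \<in> S \<Longrightarrow> w' \<in> S \<Longrightarrow> (\<And>r. r \<notin> {r1, r2, r3} \<Longrightarrow> w r = w' r) \<Longrightarrow> w = w'"
  shows "card S * (M r1 * M r2 * M r3) \<le> card (msgs M)"
proof -
  let ?f = "\<lambda>(w, x, y, z). w(r1 := x, r2 := y, r3 := z)"
  let ?X = "S \<times> {..<M r1} \<times> {..<M r2} \<times> {..<M r3}"
  have "inj_on ?f ?X"
  proof (rule inj_onI)
    fix p q assume p: "p \<in> ?X" and q: "q \<in> ?X" and eq: "?f p = ?f q"
    obtain w x y z w' x' y' z' where pq: "p = (w, x, y, z)" "q = (w', x', y', z')"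
      by (metis prod_cases4)
    have e: "(w(r1 := x, r2 := y, r3 := z)) r = (w'(r1 := x', r2 := y', r3 := z')) r" for r
      using eq by (simp add: pq)
    have "x = x'" "y = y'" "z = z'"
      using e[of r1] e[of r2] e[of r3] d by simp_all
    moreover have "w = w'"
    proof (rule det)
      show "w r = w' r" if "r \<notin> {r1, r2, r3}" for r
        using e[of r] that by simp
    qed (use p q pq in auto)
    ultimately show "p = q" by (simp add: pq)
  qed
  moreover have "?f ` ?X \<subseteq> msgs M"
    using S by (auto simp: msgs_def)
  ultimately have "card ?X \<le> card (msgs M)"
    by (intro card_inj_on_le) auto
  then show ?thesis
    by (simp add: card_cartesian_product mult_ac)
qed

lemma noise_component_second_moment:
  assumes "n < N"
  shows "(\<integral>\<^sup>+ Z. ennreal ((cmod (Z n r))\<^sup>2) \<partial>noiseM N) \<le> 4"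
proof -
  have "(\<integral>\<^sup>+ Z. ennreal ((cmod (Z n r))\<^sup>2) \<partial>noiseM N) =
      (\<integral>\<^sup>+ x. ennreal ((cmod (x r))\<^sup>2) \<partial>distr (noiseM N) rx_noise (\<lambda>Z. Z n))"
    unfolding noiseM_def using assms by (subst nn_integral_distr) auto
  also have "distr (noiseM N) rx_noise (\<lambda>Z. Z n) = rx_noise"
    unfolding noiseM_def using assms by (intro distr_PiM_component prob_space_rx_noise) auto
  also have "(\<integral>\<^sup>+ x. ennreal ((cmod (x r))\<^sup>2) \<partial>rx_noise) =
      (\<integral>\<^sup>+ z. ennreal ((cmod z)\<^sup>2) \<partial>distr rx_noise cgauss (\<lambda>x. x r))"
    by (subst nn_integral_distr) (auto simp: measurable_cong_sets[OF sets_cgauss refl])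
  also have "distr rx_noise cgauss (\<lambda>x. x r) = cgauss"
    by (intro distr_PiM_component prob_space_cgauss) auto
  also have "(\<integral>\<^sup>+ z. ennreal ((cmod z)\<^sup>2) \<partial>cgauss) \<le> 4"
    by (rule cgauss_second_moment)
  finally show ?thesis .
qed

text \<open>Product of the three bounds for \<open>gauss_ratio\<close>. Each of the shifts by
  \<open>b * z r1\<close> and \<open>b' * z r1\<close> adds \<open>2 * \<rho>^2\<close> to the
  coefficient 2 of the squared noise at \<open>r1\<close>.\<close>

lemma exp_neg_le_tilt_density:
  assumes "1 \<le> s" "cmod b \<le> \<rho>" "cmod b' \<le> \<rho>"
  shows "ennreal (exp (- (2 * ln s + 2 * (cmod m)\<^sup>2 / s\<^sup>2 + (2 + 4 * \<rho>\<^sup>2) * (cmod (z r1))\<^sup>2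
            + 2 * (cmod (z r2))\<^sup>2 + 2 * (cmod (z r3))\<^sup>2)))
         \<le> tilt_density s m b b' r1 r2 r3 z"
proof -
  have c: "(cmod (b * z r1))\<^sup>2 \<le> \<rho>\<^sup>2 * (cmod (z r1))\<^sup>2" if "cmod b \<le> \<rho>" for b
    using that by (simp add: norm_mult power_mult_distrib mult_right_mono power_mono)
  let ?e1 = "- (2 * ln s + 2 * (cmod (- m))\<^sup>2 / s\<^sup>2 + 2 * (cmod (z r1))\<^sup>2)"
  let ?e2 = "- (2 * ln 1 + 2 * (cmod (b * z r1))\<^sup>2 / 1\<^sup>2 + 2 * (cmod (z r2))\<^sup>2)"
  let ?e3 = "- (2 * ln 1 + 2 * (cmod (b' * z r1))\<^sup>2 / 1\<^sup>2 + 2 * (cmod (z r3))\<^sup>2)"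
  have "ennreal (exp (- (2 * ln s + 2 * (cmod m)\<^sup>2 / s\<^sup>2 + (2 + 4 * \<rho>\<^sup>2) * (cmod (z r1))\<^sup>2
            + 2 * (cmod (z r2))\<^sup>2 + 2 * (cmod (z r3))\<^sup>2))) \<le> ennreal (exp (?e1 + ?e2 + ?e3))"
    using c[OF assms(2)] c[OF assms(3)] by (intro ennreal_leI) (simp add: algebra_simps)
  also have "\<dots> = ennreal (exp ?e1) * ennreal (exp ?e2) * ennreal (exp ?e3)"
    by (simp only: exp_add ennreal_mult' exp_ge_zero mult_nonneg_nonneg)
  also have "\<dots> \<le> tilt_density s m b b' r1 r2 r3 z"
    unfolding tilt_density_def by (intro mult_mono exp_neg_le_gauss_ratio) (use assms in auto)
  finally show ?thesis .
qed

lemma prod_mono_ennreal: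
  fixes f g :: "'i \<Rightarrow> ennreal"
  assumes "\<And>i. i \<in> I \<Longrightarrow> f i \<le> g i"
  shows "prod f I \<le> prod g I"
  using assms by (induction I rule: infinite_finite_induct) (auto intro: mult_mono)

text \<open>Here \<open>m1\<close>, \<open>m2\<close>, \<open>m3\<close> are the noise-free
  signals at three receivers; subtracting \<open>b2 * m1\<close> from \<open>m2\<close>, or \<open>b3 * m1\<close> from \<open>m3\<close>,
  removes the dependence on the messages of \<open>r2\<close> and \<open>r3\<close>. Hence, under the tilted noise law,
  none of the three observations carries any information on the message to be decoded from it,
  and the joint success probability is at most the reciprocal of \<open>K\<close>.\<close>

lemma converse_fixed_channel:
  fixes m1 m2 m3 :: "nat \<Rightarrow> (rx \<Rightarrow> nat) \<Rightarrow> complex" and b2 b3 :: "nat \<Rightarrow> complex"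
    and \<delta>1 \<delta>2 \<delta>3 :: "(nat \<Rightarrow> complex) \<Rightarrow> nat"
    and N :: nat and r1 r2 r3 :: rx and M :: "rx \<Rightarrow> nat"
  defines "suc w Z \<equiv> \<delta>1 (\<lambda>n\<in>{..<N}. m1 n w + Z n r1) = w r1 \<and> \<delta>2 (\<lambda>n\<in>{..<N}. m2 n w + Z n r2) = w r2
       \<and> \<delta>3 (\<lambda>n\<in>{..<N}. m3 n w + Z n r3) = w r3"
  defines "K \<equiv> M r1 * M r2 * M r3"
  assumes d: "r1 \<noteq> r2" "r1 \<noteq> r3" "r2 \<noteq> r3" and M: "\<And>r. 1 \<le> M r"
    and \<delta> [measurable]: "\<delta>1 \<in> measurable (PiM {..<N} (\<lambda>_. borel)) (count_space UNIV)"
      "\<delta>2 \<in> measurable (PiM {..<N} (\<lambda>_. borel)) (count_space UNIV)"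
      "\<delta>3 \<in> measurable (PiM {..<N} (\<lambda>_. borel)) (count_space UNIV)"
    and inv2: "\<And>n w w'. (\<And>r. r \<noteq> r2 \<Longrightarrow> r \<noteq> r3 \<Longrightarrow> w r = w' r) \<Longrightarrow> n < N \<Longrightarrow>
        m2 n w - b2 n * m1 n w = m2 n w' - b2 n * m1 n w'"
    and inv3: "\<And>n w w'. (\<And>r. r \<noteq> r2 \<Longrightarrow> r \<noteq> r3 \<Longrightarrow> w r = w' r) \<Longrightarrow> n < N \<Longrightarrow>
        m3 n w - b3 n * m1 n w = m3 n w' - b3 n * m1 n w'"
    and b: "\<And>n. n < N \<Longrightarrow> cmod (b2 n) \<le> \<rho>" "\<And>n. n < N \<Longrightarrow> cmod (b3 n) \<le> \<rho>" and s: "1 \<le> s"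
  shows "of_nat (card (msgs M)) * ennreal (ln K) \<le>
     ennreal (ln K) * (\<Sum>w\<in>msgs M. \<integral>\<^sup>+ Z. (if suc w Z then 0 else 1) \<partial>noiseM N)
     + (\<Sum>w\<in>msgs M. \<Sum>n<N. ennreal (2 * ln s + 2 * (cmod (m1 n w))\<^sup>2 / s\<^sup>2 + (24 + 16 * \<rho>\<^sup>2)))
     + 2 * of_nat (card (msgs M))"
proof -
  interpret Z: prob_space "noiseM N" by (rule prob_space_noiseM)
  have K: "1 \<le> K"
    using M[of r1] M[of r2] M[of r3] by (simp add: K_def)
  define T where "T w U = (\<lambda>n\<in>{..<N}. tilt_map s (m1 n w) (b2 n) (b3 n) r1 r2 r3 (U n))" for w and U :: "nat \<Rightarrow> rx \<Rightarrow> complex"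
  define W where "W w Z = (\<Prod>n<N. tilt_density s (m1 n w) (b2 n) (b3 n) r1 r2 r3 (Z n))" for w and Z :: "nat \<Rightarrow> rx \<Rightarrow> complex"
  \<comment> \<open>Upper bound for the negative logarithm of the tilt density in channel use
    \<open>n\<close>.\<close>
  define l where "l w n Z = 2 * ln s + 2 * (cmod (m1 n w))\<^sup>2 / s\<^sup>2 + (2 + 4 * \<rho>\<^sup>2) * (cmod (Z n r1))\<^sup>2
            + 2 * (cmod (Z n r2))\<^sup>2 + 2 * (cmod (Z n r3))\<^sup>2" for w n and Z :: "nat \<Rightarrow> rx \<Rightarrow> complex"
  \<comment> \<open>A payoff of \<open>K\<close> for joint success and 1 otherwise: when success is
    pure guessing, its average over the messages is at most 2.\<close>
  define g where "g w Z = (if suc w Z then ennreal K else 1)" for w Z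
  have obs [measurable]: "(\<lambda>Z. \<lambda>n\<in>{..<N}. m n w + Z n r) \<in> measurable (noiseM N) (PiM {..<N} (\<lambda>_. borel))"
    for m :: "nat \<Rightarrow> (rx \<Rightarrow> nat) \<Rightarrow> complex" and w r
    by (intro measurable_restrict) measurable
  have [measurable]: "Measurable.pred (noiseM N) (suc w)" for w
    unfolding suc_def by measurable
  have g_meas [measurable]: "g w \<in> borel_measurable (noiseM N)" for w
    unfolding g_def by measurable
  have W_meas [measurable]: "W w \<in> borel_measurable (noiseM N)" for w
    unfolding W_def[abs_def]
    by (intro borel_measurable_prod_ennreal measurable_compose[OF measurable_noise_use measurable_tilt_density]) auto
  have l_nonneg: "0 \<le> l w n Z" for w n Z
    using s by (auto simp: l_def intro!: add_nonneg_nonneg mult_nonneg_nonneg)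
  have l_meas [measurable]: "n < N \<Longrightarrow> l w n \<in> borel_measurable (noiseM N)" for w n
    unfolding l_def[abs_def] by measurable
  \<comment> \<open>The three terms charge for a decoding failure, for the logarithm of the tilt
    density, and for the payoff under the tilted law.\<close>
  have pointwise: "ennreal (ln K) \<le> ennreal (ln K) * (if suc w Z then 0 else 1) + (\<Sum>n<N. ennreal (l w n Z)) + g w Z * W w Z" for w Z
  proof (cases "suc w Z")
    case True
    define \<Lambda> where "\<Lambda> = (\<Sum>n<N. l w n Z)"
    have "ennreal (exp (- \<Lambda>)) = (\<Prod>n<N. ennreal (exp (- l w n Z)))"
      by (simp add: \<Lambda>_def exp_sum sum_negf[symmetric] prod_ennreal)
    also have "\<dots> \<le> W w Z"
      unfolding W_def l_def by (intro prod_mono_ennreal exp_neg_le_tilt_density s b) auto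
    finally have "ennreal (K * exp (- \<Lambda>)) \<le> g w Z * W w Z"
      using True by (simp add: g_def ennreal_mult' mult_left_mono)
    \<comment> \<open>This is \<open>x \<le> exp x\<close> at \<open>x = ln K - \<Lambda>\<close>,
      which takes the place of an entropy inequality: success is compatible with a small
      \<open>\<Lambda>\<close> only if the tilted payoff is large.\<close>
    moreover have "ln K \<le> \<Lambda> + K * exp (- \<Lambda>)"
    proof -
      have "ln K - \<Lambda> \<le> exp (ln K - \<Lambda>)"
        using exp_ge_add_one_self[of "ln K - \<Lambda>"] by linarith
      also have "\<dots> = K * exp (- \<Lambda>)"
        using K by (simp add: exp_diff exp_minus divide_inverse)
      finally show ?thesis by simp
    qed
    then have "ennreal (ln K) \<le> ennreal \<Lambda> + ennreal (K * exp (- \<Lambda>))"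
      using l_nonneg by (subst ennreal_plus[symmetric]) (auto simp: \<Lambda>_def intro!: sum_nonneg ennreal_leI)
    ultimately show ?thesis
      using True l_nonneg by (simp add: \<Lambda>_def sum_ennreal) (meson add_left_mono order_trans)
  next
    case False
    then show ?thesis by (simp add: add.assoc)
  qed
  \<comment> \<open>Second moments at most 4 give the constant
    \<open>4 * (2 + 4 * \<rho>^2) + 8 + 8\<close>.\<close>
  have int_l: "(\<integral>\<^sup>+ Z. ennreal (l w n Z) \<partial>noiseM N) \<le>
      ennreal (2 * ln s + 2 * (cmod (m1 n w))\<^sup>2 / s\<^sup>2 + (24 + 16 * \<rho>\<^sup>2))" if n: "n < N" for w n
  proof -
    let ?c = "2 * ln s + 2 * (cmod (m1 n w))\<^sup>2 / s\<^sup>2"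
    have c: "0 \<le> ?c" using s by simp
    note [measurable] = n
    have split: "ennreal (c + k * x + 2 * y + 2 * z) = ennreal c + ennreal k * ennreal x + 2 * ennreal y + 2 * ennreal z"
      if "0 \<le> c" "0 \<le> k" "0 \<le> x" "0 \<le> y" "0 \<le> z" for c k x y z :: real
      using that by (simp add: ennreal_mult')
    have "ennreal (l w n Z) = ennreal ?c + ennreal (2 + 4 * \<rho>\<^sup>2) * ennreal ((cmod (Z n r1))\<^sup>2)
         + 2 * ennreal ((cmod (Z n r2))\<^sup>2) + 2 * ennreal ((cmod (Z n r3))\<^sup>2)" for Z
      unfolding l_def by (rule split) (use c in auto)
    then have "(\<integral>\<^sup>+ Z. ennreal (l w n Z) \<partial>noiseM N) =
       ennreal ?c + ennreal (2 + 4 * \<rho>\<^sup>2) * (\<integral>\<^sup>+ Z. ennreal ((cmod (Z n r1))\<^sup>2) \<partial>noiseM N)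
       + 2 * (\<integral>\<^sup>+ Z. ennreal ((cmod (Z n r2))\<^sup>2) \<partial>noiseM N)
       + 2 * (\<integral>\<^sup>+ Z. ennreal ((cmod (Z n r3))\<^sup>2) \<partial>noiseM N)"
      using n by (simp add: nn_integral_add nn_integral_cmult Z.emeasure_space_1)
    also have "\<dots> \<le> ennreal ?c + ennreal (2 + 4 * \<rho>\<^sup>2) * 4 + 2 * 4 + 2 * 4"
      by (intro add_mono mult_left_mono noise_component_second_moment n order_refl) auto
    also have "\<dots> = ennreal (?c + (2 + 4 * \<rho>\<^sup>2) * 4 + 2 * 4 + 2 * 4)"
      by (subst split) (use c in auto)
    finally show ?thesis by (simp add: algebra_simps)
  qed
  have transport: "(\<integral>\<^sup>+ Z. g w Z * W w Z \<partial>noiseM N) = (\<integral>\<^sup>+ U. g w (T w U) \<partial>noiseM N)" for w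
    unfolding W_def T_def noiseM_def
    by (rule nn_integral_PiM_transport)
       (use d s g_meas[of w, unfolded noiseM_def] in \<open>auto intro!: prob_space_rx_noise distr_tilt_map\<close>)
  have T_meas [measurable]: "T w \<in> measurable (noiseM N) (noiseM N)" for w
    unfolding T_def by (subst (2) noiseM_def)
      (auto intro!: measurable_restrict measurable_compose[OF measurable_noise_use measurable_tilt_map])
  \<comment> \<open>The noise \<open>U\<close> before tilting is held fixed and the messages are
    summed; the integral over \<open>U\<close> is taken afterwards.\<close>
  have count: "(\<Sum>w\<in>msgs M. g w (T w U)) \<le> 2 * of_nat (card (msgs M))" for U
  proof -
    define S where "S = {w \<in> msgs M. suc w (T w U)}"
    \<comment> \<open>After the tilt \<open>r1\<close> sees only \<open>U\<close>, whatever
      \<open>w\<close> is, and \<open>r2\<close>, \<open>r3\<close> see \<open>w\<close> only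
      through the combinations that do not involve their own messages. Hence \<open>w\<close> on the
      five other receivers determines first the decision of \<open>r1\<close> and then those of
      \<open>r2\<close> and \<open>r3\<close>.\<close>
    have o1: "(\<lambda>n\<in>{..<N}. m1 n w + T w U n r1) = (\<lambda>n\<in>{..<N}. s *\<^sub>R U n r1)" for w
      using d by (auto simp: T_def tilt_map_def Let_def)
    have o2: "(\<lambda>n\<in>{..<N}. m2 n w + T w U n r2) =
        (\<lambda>n\<in>{..<N}. (m2 n w - b2 n * m1 n w) + b2 n * (s *\<^sub>R U n r1) + U n r2)" for w
      using d by (auto simp: T_def tilt_map_def Let_def algebra_simps)
    have o3: "(\<lambda>n\<in>{..<N}. m3 n w + T w U n r3) =
        (\<lambda>n\<in>{..<N}. (m3 n w - b3 n * m1 n w) + b3 n * (s *\<^sub>R U n r1) + U n r3)" for w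
      using d by (auto simp: T_def tilt_map_def Let_def algebra_simps)
    have "card S * (M r1 * M r2 * M r3) \<le> card (msgs M)"
    proof (rule card_determined_msgs[OF _ d])
      fix w w' assume w: "w \<in> S" "w' \<in> S" and e: "\<And>r. r \<notin> {r1, r2, r3} \<Longrightarrow> w r = w' r"
      have 1: "w r1 = w' r1"
        using w by (simp add: S_def suc_def o1)
      have off: "w r = w' r" if "r \<noteq> r2" "r \<noteq> r3" for r
        using 1 e[of r] that by (cases "r = r1") auto
      have "m2 n w - b2 n * m1 n w = m2 n w' - b2 n * m1 n w'"
        "m3 n w - b3 n * m1 n w = m3 n w' - b3 n * m1 n w'" if "n < N" for n
        using inv2[OF off that] inv3[OF off that] by auto
      then have "(\<lambda>n\<in>{..<N}. m2 n w + T w U n r2) = (\<lambda>n\<in>{..<N}. m2 n w' + T w' U n r2)"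
        "(\<lambda>n\<in>{..<N}. m3 n w + T w U n r3) = (\<lambda>n\<in>{..<N}. m3 n w' + T w' U n r3)"
        unfolding o2 o3 by (auto intro!: restrict_ext)
      then have "w r2 = w' r2" "w r3 = w' r3"
        using w by (auto simp: S_def suc_def)
      with off show "w = w'" by (intro ext) metis
    qed (auto simp: S_def)
    then have SK: "card S * K \<le> card (msgs M)" by (simp add: K_def)
    have "(\<Sum>w\<in>msgs M. g w (T w U)) \<le> (\<Sum>w\<in>msgs M. 1 + (if w \<in> S then of_nat K else 0))"
      by (intro sum_mono) (auto simp: g_def S_def ennreal_of_nat_eq_real_of_nat)
    also have "\<dots> = of_nat (card (msgs M)) + of_nat (card S * K)"
      by (simp add: sum.distrib sum.If_cases S_def Int_def conj_commute)
    also have "\<dots> \<le> of_nat (card (msgs M)) + of_nat (card (msgs M))"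
      using SK by (intro add_left_mono) (simp only: of_nat_le_iff)
    finally show ?thesis by (simp add: mult_2)
  qed
  have "(\<Sum>w\<in>msgs M. \<integral>\<^sup>+ Z. g w Z * W w Z \<partial>noiseM N) = (\<integral>\<^sup>+ U. (\<Sum>w\<in>msgs M. g w (T w U)) \<partial>noiseM N)"
    unfolding transport by (rule nn_integral_sum[symmetric]) measurable
  also have "\<dots> \<le> (\<integral>\<^sup>+ U. 2 * of_nat (card (msgs M)) \<partial>noiseM N)"
    by (intro nn_integral_mono count)
  also have "\<dots> = 2 * of_nat (card (msgs M))"
    by (simp add: Z.emeasure_space_1)
  finally have last: "(\<Sum>w\<in>msgs M. \<integral>\<^sup>+ Z. g w Z * W w Z \<partial>noiseM N) \<le> 2 * of_nat (card (msgs M))" .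
  have each: "ennreal (ln K) \<le> ennreal (ln K) * (\<integral>\<^sup>+ Z. (if suc w Z then 0 else 1) \<partial>noiseM N)
     + (\<Sum>n<N. ennreal (2 * ln s + 2 * (cmod (m1 n w))\<^sup>2 / s\<^sup>2 + (24 + 16 * \<rho>\<^sup>2)))
     + (\<integral>\<^sup>+ Z. g w Z * W w Z \<partial>noiseM N)" for w
  proof -
    have "ennreal (ln K) = (\<integral>\<^sup>+ Z. ennreal (ln K) \<partial>noiseM N)"
      by (simp add: Z.emeasure_space_1)
    also have "\<dots> \<le> (\<integral>\<^sup>+ Z. ennreal (ln K) * (if suc w Z then 0 else 1) + (\<Sum>n<N. ennreal (l w n Z)) + g w Z * W w Z \<partial>noiseM N)"
      by (intro nn_integral_mono pointwise)
    also have "\<dots> = ennreal (ln K) * (\<integral>\<^sup>+ Z. (if suc w Z then 0 else 1) \<partial>noiseM N)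
       + (\<Sum>n<N. \<integral>\<^sup>+ Z. ennreal (l w n Z) \<partial>noiseM N) + (\<integral>\<^sup>+ Z. g w Z * W w Z \<partial>noiseM N)"
      by (subst nn_integral_add, measurable, subst nn_integral_add, measurable,
          subst nn_integral_cmult, measurable, subst nn_integral_sum) auto
    also have "\<dots> \<le> ennreal (ln K) * (\<integral>\<^sup>+ Z. (if suc w Z then 0 else 1) \<partial>noiseM N)
     + (\<Sum>n<N. ennreal (2 * ln s + 2 * (cmod (m1 n w))\<^sup>2 / s\<^sup>2 + (24 + 16 * \<rho>\<^sup>2)))
     + (\<integral>\<^sup>+ Z. g w Z * W w Z \<partial>noiseM N)"
      by (intro add_mono order_refl sum_mono int_l) auto
    finally show ?thesis .
  qed
  have "of_nat (card (msgs M)) * ennreal (ln K) = (\<Sum>w\<in>msgs M. ennreal (ln K))"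
    by simp
  also have "\<dots> \<le> (\<Sum>w\<in>msgs M. ennreal (ln K) * (\<integral>\<^sup>+ Z. (if suc w Z then 0 else 1) \<partial>noiseM N)
     + (\<Sum>n<N. ennreal (2 * ln s + 2 * (cmod (m1 n w))\<^sup>2 / s\<^sup>2 + (24 + 16 * \<rho>\<^sup>2)))
     + (\<integral>\<^sup>+ Z. g w Z * W w Z \<partial>noiseM N))"
    by (intro sum_mono each)
  also have "\<dots> = ennreal (ln K) * (\<Sum>w\<in>msgs M. \<integral>\<^sup>+ Z. (if suc w Z then 0 else 1) \<partial>noiseM N)
     + (\<Sum>w\<in>msgs M. \<Sum>n<N. ennreal (2 * ln s + 2 * (cmod (m1 n w))\<^sup>2 / s\<^sup>2 + (24 + 16 * \<rho>\<^sup>2)))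
     + (\<Sum>w\<in>msgs M. \<integral>\<^sup>+ Z. g w Z * W w Z \<partial>noiseM N)"
    by (simp add: sum.distrib sum_distrib_left)
  also have "\<dots> \<le> ennreal (ln K) * (\<Sum>w\<in>msgs M. \<integral>\<^sup>+ Z. (if suc w Z then 0 else 1) \<partial>noiseM N)
     + (\<Sum>w\<in>msgs M. \<Sum>n<N. ennreal (2 * ln s + 2 * (cmod (m1 n w))\<^sup>2 / s\<^sup>2 + (24 + 16 * \<rho>\<^sup>2)))
     + 2 * of_nat (card (msgs M))"
    by (intro add_mono order_refl last)
  finally show ?thesis .
qed

section \<open>Averaging over channels and deducing rate bounds\<close>

lemma UNIV_tx: "(UNIV :: tx set) = {A, B, C, D}"
  by (auto intro: tx.exhaust)

lemma card_tx: "card (UNIV :: tx set) = 4"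
  unfolding UNIV_tx by simp

lemma UNIV_rx: "(UNIV :: rx set) = {a1, a2, b1, b2, c1, c2, d1, d2}"
  by (auto intro: rx.exhaust)

lemma sum_tx_square_bound:
  fixes f :: "tx \<Rightarrow> real"
  shows "(\<Sum>t\<in>UNIV. f t)\<^sup>2 \<le> 4 * (\<Sum>t\<in>UNIV. (f t)\<^sup>2)"
proof -
  show ?thesis
    using Cauchy_Schwarz_ineq_sum[of "\<lambda>_. 1" f "UNIV :: tx set"] by (simp add: card_tx)
qed

context fading_channel
begin

text \<open>\<open>converse_fixed_channel\<close> is applied to almost every channel state, with
  CSIR and encoder frozen at that state, and then integrated. The error probability bounds the
  failure term and the power constraint bounds the mean of \<open>2 * |sig|^2 / s^2\<close> by 1,
  which turns 24 into 25.\<close>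

lemma converse_triple:
  assumes valid: "valid_code \<mu> \<tau> csit P N M enc dec" and \<tau>: "1 \<le> \<tau>" and P: "0 \<le> P"
    and err: "errp \<mu> \<tau> N M enc dec \<le> ennreal \<epsilon>" and \<epsilon>: "0 \<le> \<epsilon>"
    and r1: "conn r1 t" "owner r1 \<noteq> t" and r23: "r2 \<noteq> r3" "owner r2 = t" "owner r3 = t"
  shows "(1 - \<epsilon>) * ln (M r1 * M r2 * M r3) \<le> real N * (ln (1 + 32 * hmax\<^sup>2 * P) + 25 + 16 * (hmax / hmin)\<^sup>2) + 2"
proof -
  interpret G: prob_space "chanM \<mu> N" by (rule prob_space_chanM)
  interpret Z: prob_space "noiseM N" by (rule prob_space_noiseM)
  define K where "K = M r1 * M r2 * M r3"
  \<comment> \<open>The received power has mean at most \<open>4 * hmax^2 * 4 * P\<close>; twice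
    this is at most \<open>s^2\<close>. At the same time \<open>2 * ln s\<close> grows only like
    \<open>ln P\<close>.\<close>
  define s where "s = sqrt (1 + 32 * hmax\<^sup>2 * P)"
  define \<rho> where "\<rho> = hmax / hmin"
  define c where "c = card (msgs M)"
  define Cn where "Cn = 2 * ln s + (24 + 16 * \<rho>\<^sup>2)"
  define F where "F G = (\<Sum>w\<in>msgs M. \<integral>\<^sup>+ Z. (if \<exists>r. dec r (restrict (rxsig \<tau> enc w G Z r) {..<N}) (csir \<tau> N G r) \<noteq> w r
           then 1 else 0) \<partial>noiseM N)" for G
  define H where "H G = (\<Sum>w\<in>msgs M. \<Sum>n<N. ennreal Cn + ennreal (8 * hmax\<^sup>2 / s\<^sup>2) * (\<Sum>t\<in>UNIV. ennreal ((cmod (enc t n w G))\<^sup>2)))" for G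
  note E [measurable] = measurable_encoder[OF valid]
  have s: "1 \<le> s" "s\<^sup>2 = 1 + 32 * hmax\<^sup>2 * P"
    using P by (simp_all add: s_def)
  have M: "1 \<le> M r" for r using valid by (simp add: valid_code_def)
  have c: "0 < c" unfolding c_def by (rule card_msgs_pos) (rule M)
  have K: "1 \<le> K" using M[of r1] M[of r2] M[of r3] by (simp add: K_def)
  have Cn: "0 \<le> Cn" using s by (simp add: Cn_def)
  have d: "r1 \<noteq> r2" "r1 \<noteq> r3" using r1 r23 by auto
  have F_meas [measurable]: "F \<in> borel_measurable (chanM \<mu> N)"
    unfolding F_def using Z.borel_measurable_nn_integral[OF measurable_error_event[OF valid \<tau>]]
    by (intro borel_measurable_sum) simp
  have H_meas [measurable]: "H \<in> borel_measurable (chanM \<mu> N)"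
    unfolding H_def by measurable
  have main: "of_nat c * ennreal (ln K) \<le> ennreal (ln K) * F G + H G + 2 * of_nat c"
    if range: "\<forall>n r t. n < N \<longrightarrow> conn r t \<longrightarrow> hmin \<le> cmod (G n (r, t)) \<and> cmod (G n (r, t)) \<le> hmax" for G
  proof -
    define sig where "sig r n w = (\<Sum>t\<in>UNIV. if conn r t then G (n div \<tau>) (r, t) * enc t n w G else 0)" for r n w
    \<comment> \<open>Ratio of the gains from transmitter \<open>t\<close>: subtracting
      \<open>b r n\<close> times the signal of \<open>r1\<close> cancels the contribution of
      \<open>t\<close> to that of \<open>r\<close>.\<close>
    define b where "b r n = G (n div \<tau>) (r, t) / G (n div \<tau>) (r1, t)" for r n
    have rng: "hmin \<le> cmod (G (n div \<tau>) (r, t))" "cmod (G (n div \<tau>) (r, t)) \<le> hmax" if "n < N" "conn r t" for n r t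
      using range that le_less_trans[OF div_le_dividend[of n \<tau>], of N] by auto
    have inv: "sig r n w - b r n * sig r1 n w = sig r n w' - b r n * sig r1 n w'"
      if w: "\<And>r. r \<noteq> r2 \<Longrightarrow> r \<noteq> r3 \<Longrightarrow> w r = w' r" and n: "n < N" and r: "owner r = t" for r n w w'
    proof -
      have "conn r t" using r conn_owner[of r] by simp
      have nz: "G (n div \<tau>) (r1, t) \<noteq> 0"
        using rng(1)[OF n r1(1)] hmin by auto
      \<comment> \<open>The messages of \<open>r2\<close> and \<open>r3\<close> reach the channel
        only through transmitter \<open>t\<close>, even under CSIT.\<close>
      have step: "enc u n w G = enc u n w' G" if "u \<noteq> t" for u
      proof -
        have "\<forall>r. owner r = u \<longrightarrow> w r = w' r" using that w r23 by metis
        then show ?thesis using valid unfolding valid_code_def by blast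
      qed
      have "sig r n v - b r n * sig r1 n v =
          (\<Sum>u\<in>UNIV. (if conn r u then G (n div \<tau>) (r, u) * enc u n v G else 0)
             - b r n * (if conn r1 u then G (n div \<tau>) (r1, u) * enc u n v G else 0))" for v
        by (simp only: sig_def sum_distrib_left sum_subtractf)
      moreover have "(if conn r u then G (n div \<tau>) (r, u) * enc u n w G else 0)
             - b r n * (if conn r1 u then G (n div \<tau>) (r1, u) * enc u n w G else 0) =
          (if conn r u then G (n div \<tau>) (r, u) * enc u n w' G else 0)
             - b r n * (if conn r1 u then G (n div \<tau>) (r1, u) * enc u n w' G else 0)" for u
      proof (cases "u = t")
        case True
        then show ?thesis using nz r1 \<open>conn r t\<close> by (simp add: b_def)
      qed (simp add: step)
      ultimately show ?thesis by simp
    qed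
    have bb: "cmod (b r n) \<le> \<rho>" if "n < N" "owner r = t" for r n
    proof -
      have "conn r t" using that conn_owner[of r] by simp
      then show ?thesis
        unfolding b_def \<rho>_def norm_divide
        using rng[OF that(1), of r t] rng[OF that(1) r1(1)] hmin hmax hmin_le_hmax
        by (intro frac_le) auto
    qed
    have dec: "(\<lambda>y. dec r y (csir \<tau> N G r)) \<in> measurable (PiM {..<N} (\<lambda>_. borel)) (count_space UNIV)" for r
      using valid by (intro measurable_decoder_fixed) (simp add: valid_code_def)
    have "of_nat c * ennreal (ln K) \<le> ennreal (ln K) * (\<Sum>w\<in>msgs M. \<integral>\<^sup>+ Z.
         (if dec r1 (\<lambda>n\<in>{..<N}. sig r1 n w + Z n r1) (csir \<tau> N G r1) = w r1 \<and>
             dec r2 (\<lambda>n\<in>{..<N}. sig r2 n w + Z n r2) (csir \<tau> N G r2) = w r2 \<and>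
             dec r3 (\<lambda>n\<in>{..<N}. sig r3 n w + Z n r3) (csir \<tau> N G r3) = w r3 then 0 else 1) \<partial>noiseM N)
       + (\<Sum>w\<in>msgs M. \<Sum>n<N. ennreal (2 * ln s + 2 * (cmod (sig r1 n w))\<^sup>2 / s\<^sup>2 + (24 + 16 * \<rho>\<^sup>2)))
       + 2 * of_nat c"
      unfolding c_def K_def
      by (rule converse_fixed_channel[where ?m1.0="sig r1" and ?m2.0="sig r2" and ?m3.0="sig r3"
          and ?b2.0="b r2" and ?b3.0="b r3" and ?\<delta>1.0="\<lambda>y. dec r1 y (csir \<tau> N G r1)"
          and ?\<delta>2.0="\<lambda>y. dec r2 y (csir \<tau> N G r2)" and ?\<delta>3.0="\<lambda>y. dec r3 y (csir \<tau> N G r3)",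
          OF d r23(1) M dec dec dec inv[OF _ _ r23(2)] inv[OF _ _ r23(3)] bb[OF _ r23(2)] bb[OF _ r23(3)] s(1)])
    also have "\<dots> \<le> ennreal (ln K) * F G + H G + 2 * of_nat c"
      unfolding F_def H_def
    proof (intro add_mono mult_left_mono sum_mono order_refl nn_integral_mono)
      fix w and Z :: "nat \<Rightarrow> rx \<Rightarrow> complex"
      show "(if dec r1 (\<lambda>n\<in>{..<N}. sig r1 n w + Z n r1) (csir \<tau> N G r1) = w r1 \<and>
             dec r2 (\<lambda>n\<in>{..<N}. sig r2 n w + Z n r2) (csir \<tau> N G r2) = w r2 \<and>
             dec r3 (\<lambda>n\<in>{..<N}. sig r3 n w + Z n r3) (csir \<tau> N G r3) = w r3 then 0 else 1)
          \<le> (if \<exists>r. dec r (restrict (rxsig \<tau> enc w G Z r) {..<N}) (csir \<tau> N G r) \<noteq> w r then 1 else 0 :: ennreal)"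
        unfolding sig_def rxsig_def[abs_def] by auto
    next
      fix w n assume "n \<in> {..<N}"
      then have n: "n < N" by simp
      have "cmod (sig r1 n w) \<le> (\<Sum>t\<in>UNIV. hmax * cmod (enc t n w G))"
        unfolding sig_def
      proof (rule order_trans[OF norm_sum], rule sum_mono)
        fix u show "cmod (if conn r1 u then G (n div \<tau>) (r1, u) * enc u n w G else 0) \<le> hmax * cmod (enc u n w G)"
          using rng(2)[OF n, of r1 u] hmax by (auto simp: norm_mult mult_right_mono)
      qed
      then have "(cmod (sig r1 n w))\<^sup>2 \<le> (\<Sum>t\<in>UNIV. hmax * cmod (enc t n w G))\<^sup>2"
        by (intro power_mono) auto
      also have "\<dots> \<le> 4 * (\<Sum>t\<in>UNIV. (hmax * cmod (enc t n w G))\<^sup>2)"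
        by (rule sum_tx_square_bound)
      also have "\<dots> = 4 * hmax\<^sup>2 * (\<Sum>t\<in>UNIV. (cmod (enc t n w G))\<^sup>2)"
        by (simp add: power_mult_distrib sum_distrib_left mult.assoc)
      finally have "2 * (cmod (sig r1 n w))\<^sup>2 \<le> 8 * hmax\<^sup>2 * (\<Sum>t\<in>UNIV. (cmod (enc t n w G))\<^sup>2)"
        by simp
      from divide_right_mono[OF this, of "s\<^sup>2"]
      have "2 * (cmod (sig r1 n w))\<^sup>2 / s\<^sup>2 \<le> 8 * hmax\<^sup>2 / s\<^sup>2 * (\<Sum>t\<in>UNIV. (cmod (enc t n w G))\<^sup>2)"
        by simp
      then have "ennreal (2 * ln s + 2 * (cmod (sig r1 n w))\<^sup>2 / s\<^sup>2 + (24 + 16 * \<rho>\<^sup>2)) \<le>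
          ennreal (Cn + 8 * hmax\<^sup>2 / s\<^sup>2 * (\<Sum>t\<in>UNIV. (cmod (enc t n w G))\<^sup>2))"
        unfolding Cn_def by (intro ennreal_leI) linarith
      also have "\<dots> = ennreal Cn + ennreal (8 * hmax\<^sup>2 / s\<^sup>2) * (\<Sum>t\<in>UNIV. ennreal ((cmod (enc t n w G))\<^sup>2))"
        using Cn by (simp add: ennreal_mult' sum_nonneg sum_ennreal del: times_divide_eq_left)
      finally show "ennreal (2 * ln s + 2 * (cmod (sig r1 n w))\<^sup>2 / s\<^sup>2 + (24 + 16 * \<rho>\<^sup>2)) \<le>
          ennreal Cn + ennreal (8 * hmax\<^sup>2 / s\<^sup>2) * (\<Sum>t\<in>UNIV. ennreal ((cmod (enc t n w G))\<^sup>2))" .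
    qed auto
    finally show ?thesis .
  qed
  have intF: "(\<integral>\<^sup>+ G. F G \<partial>chanM \<mu> N) \<le> ennreal (\<epsilon> * c)"
  proof -
    have "(\<integral>\<^sup>+ G. F G \<partial>chanM \<mu> N) = (\<Sum>w\<in>msgs M. \<integral>\<^sup>+ G. \<integral>\<^sup>+ Z. (if \<exists>r. dec r (restrict (rxsig \<tau> enc w G Z r) {..<N}) (csir \<tau> N G r) \<noteq> w r
           then 1 else 0) \<partial>noiseM N \<partial>chanM \<mu> N)"
      unfolding F_def using Z.borel_measurable_nn_integral[OF measurable_error_event[OF valid \<tau>]]
      by (intro nn_integral_sum) simp
    also have "\<dots> = errp \<mu> \<tau> N M enc dec * of_nat c"
      unfolding errp_def c_def[symmetric] using c by (simp add: ennreal_divide_times less_top[symmetric])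
    also have "\<dots> \<le> ennreal \<epsilon> * of_nat c"
      by (intro mult_right_mono err) auto
    also have "\<dots> = ennreal (\<epsilon> * c)"
      using \<epsilon> by (simp add: ennreal_mult' ennreal_of_nat_eq_real_of_nat)
    finally show ?thesis .
  qed
  have intH: "(\<integral>\<^sup>+ G. H G \<partial>chanM \<mu> N) \<le> ennreal (c * N * (Cn + 1))"
  proof -
    define k where "k = 8 * hmax\<^sup>2 / s\<^sup>2"
    have "0 < s\<^sup>2" using s(1) by simp
    have k: "0 \<le> k" by (simp add: k_def)
    have kP: "4 * k * P \<le> 1"
      using s(2) \<open>0 < s\<^sup>2\<close> by (simp add: k_def mult.assoc)
    have "(\<integral>\<^sup>+ G. H G \<partial>chanM \<mu> N) =
       (\<Sum>w\<in>msgs M. \<Sum>n<N. ennreal Cn + ennreal k * (\<Sum>t\<in>UNIV. \<integral>\<^sup>+ G. ennreal ((cmod (enc t n w G))\<^sup>2) \<partial>chanM \<mu> N))"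
      unfolding H_def k_def by (simp add: nn_integral_sum nn_integral_add nn_integral_cmult G.emeasure_space_1 del: sum_ennreal)
    also have "\<dots> = (\<Sum>n<N. \<Sum>w\<in>msgs M. ennreal Cn) + (\<Sum>n<N. ennreal k * (\<Sum>t\<in>UNIV. \<Sum>w\<in>msgs M. \<integral>\<^sup>+ G. ennreal ((cmod (enc t n w G))\<^sup>2) \<partial>chanM \<mu> N))"
      by (subst sum.swap) (simp only: sum.distrib sum_distrib_left[symmetric] sum.swap[of _ "msgs M" UNIV])
    also have "\<dots> \<le> (\<Sum>n<N. \<Sum>w\<in>msgs M. ennreal Cn) + (\<Sum>n<N. ennreal k * (\<Sum>t\<in>(UNIV :: tx set). ennreal P * of_nat c))"
      using valid unfolding valid_code_def c_def
      by (intro add_mono order_refl sum_mono mult_left_mono) auto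
    also have "\<dots> = ennreal (c * N * (Cn + 4 * k * P))"
    proof -
      have "(\<Sum>n<N. \<Sum>w\<in>msgs M. ennreal Cn) + (\<Sum>n<N. ennreal k * (\<Sum>t\<in>(UNIV :: tx set). ennreal P * of_nat c)) =
         ennreal N * (ennreal c * ennreal Cn) + ennreal N * (ennreal k * (ennreal 4 * (ennreal P * ennreal c)))"
        by (simp add: c_def card_tx ennreal_of_nat_eq_real_of_nat)
      also have "\<dots> = ennreal (N * (c * Cn) + N * (k * (4 * (P * c))))"
        using Cn k P by (simp only: ennreal_mult'[symmetric] ennreal_plus[symmetric] of_nat_0_le_iff mult_nonneg_nonneg zero_le_numeral)
      also have "N * (c * Cn) + N * (k * (4 * (P * c))) = c * N * (Cn + 4 * k * P)"
        by (simp add: algebra_simps)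
      finally show ?thesis .
    qed
    also have "\<dots> \<le> ennreal (c * N * (Cn + 1))"
      using kP by (intro ennreal_leI mult_left_mono) auto
    finally show ?thesis .
  qed
  have "of_nat c * ennreal (ln K) = (\<integral>\<^sup>+ G. of_nat c * ennreal (ln K) \<partial>chanM \<mu> N)"
    by (simp add: G.emeasure_space_1)
  also have "\<dots> \<le> (\<integral>\<^sup>+ G. ennreal (ln K) * F G + H G + 2 * of_nat c \<partial>chanM \<mu> N)"
    by (rule nn_integral_mono_AE, rule AE_mp[OF AE_chan_range[of N]], rule AE_I2, rule impI, rule main)
  also have "\<dots> = ennreal (ln K) * (\<integral>\<^sup>+ G. F G \<partial>chanM \<mu> N) + (\<integral>\<^sup>+ G. H G \<partial>chanM \<mu> N) + 2 * of_nat c"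
    by (simp add: nn_integral_add nn_integral_cmult G.emeasure_space_1)
  also have "\<dots> \<le> ennreal (ln K) * ennreal (\<epsilon> * c) + ennreal (c * N * (Cn + 1)) + 2 * of_nat c"
    by (intro add_mono mult_left_mono intF intH order_refl) auto
  also have "\<dots> = ennreal (ln K * (\<epsilon> * c) + c * N * (Cn + 1) + 2 * c)"
    using K \<epsilon> Cn by (simp add: ennreal_mult' ennreal_of_nat_eq_real_of_nat)
  finally have "ennreal (c * ln K) \<le> ennreal (ln K * (\<epsilon> * c) + c * N * (Cn + 1) + 2 * c)"
    using K by (simp add: ennreal_mult' ennreal_of_nat_eq_real_of_nat)
  then have "c * ln K \<le> ln K * (\<epsilon> * c) + c * N * (Cn + 1) + 2 * c"
    using K \<epsilon> Cn by (subst (asm) ennreal_le_iff) (auto intro!: add_nonneg_nonneg mult_nonneg_nonneg)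
  then have "real c * ln K \<le> real c * (\<epsilon> * ln K + N * (Cn + 1) + 2)"
    by (simp add: algebra_simps)
  then have "ln K \<le> \<epsilon> * ln K + N * (Cn + 1) + 2"
    using c by simp
  moreover have "2 * ln s = ln (1 + 32 * hmax\<^sup>2 * P)"
    using s P by (simp add: s_def ln_sqrt)
  ultimately show ?thesis
    by (simp add: K_def Cn_def \<rho>_def algebra_simps)
qed

text \<open>With error and rate slack \<open>\<delta>\<close> and block length at least
  \<open>1 / \<delta>\<close>, the additive 2 of \<open>converse_triple\<close> costs at most
  \<open>2 * \<delta>\<close> per channel use. Then \<open>\<delta>\<close> tends to 0.\<close>

lemma rate_triple_bound:
  assumes ach: "achievable \<mu> \<tau>max csit P R" and P: "0 \<le> P"
    and r1: "conn r1 t" "owner r1 \<noteq> t" and r23: "r2 \<noteq> r3" "owner r2 = t" "owner r3 = t"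
  shows "R r1 + R r2 + R r3 \<le> ln (1 + 32 * hmax\<^sup>2 * P) + 25 + 16 * (hmax / hmin)\<^sup>2"
proof -
  define c where "c = ln (1 + 32 * hmax\<^sup>2 * P) + 25 + 16 * (hmax / hmin)\<^sup>2"
  define S where "S = R r1 + R r2 + R r3"
  have ineq: "(1 - \<delta>) * (S - 3 * \<delta>) - 2 * \<delta> \<le> c" if \<delta>: "0 < \<delta>" "\<delta> < 1" for \<delta>
  proof -
    obtain \<tau> where \<tau>: "1 \<le> \<tau>" and *: "\<forall>\<epsilon>>0. \<forall>N0. \<exists>N\<ge>N0. \<exists>M enc dec. 0 < N \<and>
        valid_code \<mu> \<tau> csit P N M enc dec \<and> (\<forall>r. R r - \<epsilon> \<le> ln (real (M r)) / real N) \<and>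
        errp \<mu> \<tau> N M enc dec \<le> ennreal \<epsilon>"
      using ach unfolding achievable_def by auto
    from * \<delta> obtain N M enc dec where N: "nat \<lceil>1 / \<delta>\<rceil> \<le> N" "0 < N"
      and valid: "valid_code \<mu> \<tau> csit P N M enc dec"
      and rate: "\<And>r. R r - \<delta> \<le> ln (real (M r)) / real N"
      and err: "errp \<mu> \<tau> N M enc dec \<le> ennreal \<delta>"
      by metis
    have M: "0 < M r" for r
      using valid by (simp add: valid_code_def Suc_le_eq)
    have "S - 3 * \<delta> \<le> ln (M r1) / N + ln (M r2) / N + ln (M r3) / N"
      using rate[of r1] rate[of r2] rate[of r3] by (simp add: S_def)
    also have "\<dots> = ln (M r1 * M r2 * M r3) / N"
      using M by (simp add: ln_mult add_divide_distrib)
    finally have "(1 - \<delta>) * (S - 3 * \<delta>) \<le> (1 - \<delta>) * (ln (M r1 * M r2 * M r3) / N)"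
      using \<delta> by (intro mult_left_mono) auto
    also have "\<dots> \<le> (real N * c + 2) / N"
      using converse_triple[OF valid \<tau> P err _ r1 r23] \<delta> N
      by (simp add: c_def divide_right_mono)
    also have "\<dots> = c + 2 / N"
      using N by (simp add: add_divide_distrib)
    also have "2 / N \<le> 2 * \<delta>"
    proof -
      have "1 / \<delta> \<le> N" using N(1) by linarith
      then show ?thesis using \<delta> N by (simp add: field_simps)
    qed
    finally show ?thesis by simp
  qed
  have "((\<lambda>\<delta>. (1 - \<delta>) * (S - 3 * \<delta>) - 2 * \<delta>) \<longlongrightarrow> (1 - 0) * (S - 3 * 0) - 2 * 0) (at_right 0)"
    by (intro tendsto_intros)
  moreover have "eventually (\<lambda>\<delta>. (1 - \<delta>) * (S - 3 * \<delta>) - 2 * \<delta> \<le> c) (at_right 0)"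
    unfolding eventually_at_right_field using ineq by (intro exI[of _ 1]) auto
  ultimately have "(1 - 0) * (S - 3 * 0) - 2 * 0 \<le> c"
    by (rule tendsto_upperbound) simp
  then show ?thesis by (simp add: S_def c_def)
qed

text \<open>Every receiver is once the first of a triple, next to the two receivers of its
  interfering transmitter. A transmitter interferes at exactly two receivers, so each rate is also
  counted twice in a pair, hence three times in all.\<close>

lemma sum_rate_bound:
  assumes ach: "achievable \<mu> \<tau>max csit P R" and P: "0 \<le> P"
  shows "(\<Sum>r\<in>UNIV. R r) \<le> 8 / 3 * (ln (1 + 32 * hmax\<^sup>2 * P) + 25 + 16 * (hmax / hmin)\<^sup>2)"
proof -
  note bound = rate_triple_bound[OF ach P]
  show ?thesis
    unfolding UNIV_rx
    using bound[of a1 B b1 b2] bound[of b1 A a1 a2] bound[of a2 C c1 c2] bound[of c2 A a1 a2]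
      bound[of c1 D d1 d2] bound[of d1 C c1 c2] bound[of b2 D d1 d2] bound[of d2 B b1 b2]
    by simp
qed

end

section \<open>The Gilbert-Varshamov bound\<close>

text \<open>Values off \<open>S\<close> are prescribed, so restriction to \<open>S\<close> is
  injective.\<close>

lemma card_words_agreeing_off:
  assumes "S \<subseteq> {..<K::nat}"
  shows "card {x \<in> {..<K} \<rightarrow>\<^sub>E {..<Q::nat}. \<forall>k\<in>{..<K} - S. x k = c k} \<le> Q ^ card S"
proof -
  let ?X = "{x \<in> {..<K} \<rightarrow>\<^sub>E {..<Q}. \<forall>k\<in>{..<K} - S. x k = c k}"
  have "inj_on (\<lambda>x. restrict x S) ?X"
  proof (rule inj_onI)
    fix x y assume x: "x \<in> ?X" and y: "y \<in> ?X" and eq: "restrict x S = restrict y S"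
    show "x = y"
    proof
      fix k
      consider "k \<in> S" | "k \<in> {..<K} - S" | "k \<notin> {..<K}" by blast
      then show "x k = y k"
      proof cases
        case 1
        then show ?thesis using fun_cong[OF eq, of k] by simp
      next
        case 2
        then show ?thesis using x y by simp
      next
        case 3
        have "x k = undefined" by (rule PiE_arb[OF conjunct1[OF CollectD[OF x]] 3])
        moreover have "y k = undefined" by (rule PiE_arb[OF conjunct1[OF CollectD[OF y]] 3])
        ultimately show ?thesis by simp
      qed
    qed
  qed
  moreover have "(\<lambda>x. restrict x S) ` ?X \<subseteq> S \<rightarrow>\<^sub>E {..<Q}"
  proof
    fix y assume "y \<in> (\<lambda>x. restrict x S) ` ?X"
    then obtain x where "y = restrict x S" "x \<in> {..<K} \<rightarrow>\<^sub>E {..<Q}" by blast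
    then show "y \<in> S \<rightarrow>\<^sub>E {..<Q}"
      using assms PiE_mem[of x "{..<K}" "\<lambda>_. {..<Q}"] by (simp add: subset_iff)
  qed
  moreover have fin: "finite S" by (rule finite_subset[OF assms]) simp
  moreover have "finite (S \<rightarrow>\<^sub>E {..<Q})" using fin by (intro finite_PiE) simp_all
  ultimately have "card ?X \<le> card (S \<rightarrow>\<^sub>E {..<Q})"
    by (intro card_inj_on_le)
  then show ?thesis using fin by (simp add: card_PiE)
qed

text \<open>Union bound over the sets of differing positions, of which there are at most
  \<open>2 ^ K\<close>. This factor costs \<open>ln 2\<close> per symbol, which vanishes against
  \<open>ln Q\<close> as the alphabet grows.\<close>

lemma card_hamming_ball:
  assumes "1 \<le> Q"
  shows "card {x \<in> {..<K} \<rightarrow>\<^sub>E {..<Q::nat}. card {k\<in>{..<K}. x k \<noteq> c k} < d} \<le> 2 ^ K * Q ^ d"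
proof -
  let ?H = "\<lambda>S. {x \<in> {..<K} \<rightarrow>\<^sub>E {..<Q}. \<forall>k\<in>{..<K} - S. x k = c k}"
  let ?I = "{S \<in> Pow {..<K}. card S < d}"
  have fin: "finite ({..<K} \<rightarrow>\<^sub>E {..<Q})" by (intro finite_PiE) auto
  have "{x \<in> {..<K} \<rightarrow>\<^sub>E {..<Q}. card {k\<in>{..<K}. x k \<noteq> c k} < d} \<subseteq> (\<Union>S\<in>?I. ?H S)"
  proof
    fix x assume "x \<in> {x \<in> {..<K} \<rightarrow>\<^sub>E {..<Q}. card {k\<in>{..<K}. x k \<noteq> c k} < d}"
    note x = CollectD[OF this]
    have "{k\<in>{..<K}. x k \<noteq> c k} \<in> ?I"
      by (intro CollectI conjI conjunct2[OF x] PowI Collect_restrict)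
    moreover have "x \<in> ?H {k\<in>{..<K}. x k \<noteq> c k}"
      by (intro CollectI conjI conjunct1[OF x]) simp
    ultimately show "x \<in> (\<Union>S\<in>?I. ?H S)" by (rule UN_I)
  qed
  then have "card {x \<in> {..<K} \<rightarrow>\<^sub>E {..<Q}. card {k\<in>{..<K}. x k \<noteq> c k} < d} \<le> card (\<Union>S\<in>?I. ?H S)"
    by (intro card_mono finite_UN_I) (auto intro: finite_subset[OF _ fin])
  also have "\<dots> \<le> (\<Sum>S\<in>?I. card (?H S))"
    by (intro card_UN_le) auto
  also have "\<dots> \<le> (\<Sum>S\<in>?I. Q ^ d)"
  proof (rule sum_mono)
    fix S assume S: "S \<in> ?I"
    then have "card (?H S) \<le> Q ^ card S" by (intro card_words_agreeing_off) auto
    also have "\<dots> \<le> Q ^ d" using S assms by (intro power_increasing) auto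
    finally show "card (?H S) \<le> Q ^ d" .
  qed
  also have "\<dots> = card ?I * Q ^ d" by simp
  also have "card ?I \<le> card (Pow {..<K})" by (intro card_mono) auto
  finally show ?thesis by (simp add: card_Pow)
qed

lemma gilbert_varshamov:
  assumes Q: "1 \<le> Q" and d: "1 \<le> d"
  obtains V where "V \<subseteq> {..<K} \<rightarrow>\<^sub>E {..<Q::nat}"
    and "\<forall>x\<in>V. \<forall>y\<in>V. x \<noteq> y \<longrightarrow> d \<le> card {k\<in>{..<K}. x k \<noteq> y k}"
    and "Q ^ K \<le> card V * (2 ^ K * Q ^ d)"
proof -
  let ?W = "{..<K} \<rightarrow>\<^sub>E {..<Q}"
  define good where "good V \<longleftrightarrow> V \<subseteq> ?W \<and> (\<forall>x\<in>V. \<forall>y\<in>V. x \<noteq> y \<longrightarrow> d \<le> card {k\<in>{..<K}. x k \<noteq> y k})" for V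
  have fin: "finite ?W" by (intro finite_PiE) auto
  have "finite {V. good V}"
    by (rule finite_subset[of _ "Pow ?W"]) (auto simp: good_def fin)
  moreover have "{} \<in> {V. good V}" by (simp add: good_def)
  ultimately obtain V where V: "good V" and max: "\<And>V'. good V' \<Longrightarrow> V \<subseteq> V' \<Longrightarrow> V = V'"
    using finite_has_maximal[of "{V. good V}"] by blast
  have finV: "finite V" using V by (intro finite_subset[OF _ fin]) (simp add: good_def)
  let ?E = "\<lambda>c. {x \<in> ?W. card {k\<in>{..<K}. x k \<noteq> c k} < d}"
  \<comment> \<open>The balls around a maximal code cover all words, since an uncovered word could
    be added. Positivity of \<open>d\<close> excludes that this word already belongs to the
    code.\<close>
  have cover: "?W \<subseteq> (\<Union>c\<in>V. ?E c)"
  proof (rule ccontr)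
    assume "\<not> ?W \<subseteq> (\<Union>c\<in>V. ?E c)"
    then obtain x where x: "x \<in> ?W" and "x \<notin> (\<Union>c\<in>V. ?E c)" by blast
    then have far: "d \<le> card {k\<in>{..<K}. x k \<noteq> c k}" if "c \<in> V" for c
      using that by (simp add: not_less)
    have far': "d \<le> card {k\<in>{..<K}. c k \<noteq> x k}" if "c \<in> V" for c
      using far[OF that] by (simp add: eq_commute)
    have "good (insert x V)"
      using V x far far' by (auto simp: good_def)
    then have "x \<in> V" using max[of "insert x V"] by blast
    from far[OF this] d show False by simp
  qed
  have "Q ^ K = card ?W" by (simp add: card_PiE)
  also have "\<dots> \<le> card (\<Union>c\<in>V. ?E c)"
    by (intro card_mono cover finite_UN_I finV) (auto intro: finite_subset[OF _ fin])
  also have "\<dots> \<le> (\<Sum>c\<in>V. card (?E c))"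
    by (intro card_UN_le finV)
  also have "\<dots> \<le> (\<Sum>c\<in>V. 2 ^ K * Q ^ d)"
    by (intro sum_mono card_hamming_ball Q)
  also have "\<dots> = card V * (2 ^ K * Q ^ d)" by simp
  finally show thesis
    using that[of V] V by (auto simp: good_def)
qed

section \<open>Rarity of large noise\<close>

lemma noise_tail:
  assumes "0 < \<eta>"
  obtains t where "0 < t" "emeasure rx_noise {x. \<exists>r. t \<le> cmod (x r)} \<le> ennreal \<eta>"
proof -
  interpret R: prob_space rx_noise by (rule prob_space_rx_noise)
  let ?E = "\<lambda>i. {x :: rx \<Rightarrow> complex. \<exists>r. real i \<le> cmod (x r)}"
  have sp: "space rx_noise = UNIV" by (simp add: space_PiM)
  have E: "{x. \<exists>r. t \<le> cmod (x r)} \<in> sets rx_noise" for t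
  proof -
    have "{x \<in> space rx_noise. \<exists>r. t \<le> cmod (x r)} \<in> sets rx_noise" by measurable
    then show ?thesis by (simp add: sp)
  qed
  \<comment> \<open>Continuity from above: the events shrink to the empty set because only finitely
    many noise values are involved.\<close>
  have "decseq ?E"
    unfolding decseq_def by (auto intro: order_trans[OF of_nat_mono])
  then have "(\<lambda>i. measure rx_noise (?E i)) \<longlonglongrightarrow> measure rx_noise (\<Inter>i. ?E i)"
    using E by (intro R.finite_Lim_measure_decseq) auto
  moreover have "(\<Inter>i. ?E i) = {}"
  proof (rule ccontr)
    assume "(\<Inter>i. ?E i) \<noteq> {}"
    then obtain x :: "rx \<Rightarrow> complex" where x: "\<forall>i. \<exists>r. real i \<le> cmod (x r)" by auto
    obtain i where i: "(\<Sum>r\<in>UNIV. cmod (x r)) < real i" using reals_Archimedean2 by blast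
    obtain r where "real i \<le> cmod (x r)" using x by blast
    also have "\<dots> \<le> (\<Sum>r\<in>UNIV. cmod (x r))"
      by (rule member_le_sum) auto
    finally show False using i by simp
  qed
  ultimately have "(\<lambda>i. measure rx_noise (?E i)) \<longlonglongrightarrow> 0" by simp
  then have "eventually (\<lambda>i. measure rx_noise (?E i) < \<eta>) sequentially"
    using assms by (rule order_tendstoD)
  then have "eventually (\<lambda>i. 0 < i \<and> measure rx_noise (?E i) < \<eta>) sequentially"
    using eventually_gt_at_top[of 0] by eventually_elim simp
  then obtain i where i: "0 < i" "measure rx_noise (?E i) < \<eta>"
    using eventually_happens'[OF sequentially_bot] by blast
  show thesis
  proof (rule that[of "real i"])
    show "emeasure rx_noise {x. \<exists>r. real i \<le> cmod (x r)} \<le> ennreal \<eta>"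
      unfolding R.emeasure_eq_measure by (rule ennreal_leI) (use i(2) in simp)
  qed (use i(1) in simp)
qed

lemma ennreal_2_power: "ennreal (2 ^ k) = 2 ^ k"
  using ennreal_power[of 2 k] by simp

text \<open>Chernoff bound with weight \<open>2 ^ (l + 1)\<close> on each bad use. The mean weight
  of one use is at most 2, so that of all uses is at most \<open>2 ^ (l * j)\<close>, whereas
  \<open>j\<close> bad uses already weigh \<open>2 ^ ((l + 1) * j)\<close>. The quotient is
  \<open>(1/2) ^ j\<close>.\<close>

lemma bad_uses_chernoff:
  assumes E [measurable]: "E \<in> sets rx_noise" and p: "emeasure rx_noise E \<le> ennreal ((1/2) ^ (l + 1))"
  shows "(\<integral>\<^sup>+ Z. (if j \<le> card {n\<in>{..<l * j}. Z n \<in> E} then 1 else 0) \<partial>noiseM (l * j)) \<le> ennreal ((1/2) ^ j)"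
proof -
  interpret R: prob_space rx_noise by (rule prob_space_rx_noise)
  interpret P: product_prob_space "\<lambda>_. rx_noise" by (intro product_prob_spaceI prob_space_rx_noise)
  let ?a = "2 ^ (l + 1) :: ennreal"
  let ?f = "\<lambda>x. if x \<in> E then ?a else 1"
  have "(\<integral>\<^sup>+ x. ?f x \<partial>rx_noise) \<le> (\<integral>\<^sup>+ x. 1 + ?a * indicator E x \<partial>rx_noise)"
    by (intro nn_integral_mono) (auto simp: indicator_def)
  also have "\<dots> = 1 + ?a * emeasure rx_noise E"
    by (simp add: nn_integral_add nn_integral_cmult R.emeasure_space_1)
  also have "\<dots> \<le> 1 + ?a * ennreal ((1/2) ^ (l + 1))"
    by (intro add_left_mono mult_left_mono p) auto
  also have "?a * ennreal ((1/2) ^ (l + 1)) = ennreal (2 ^ (l + 1) * (1/2) ^ (l + 1))"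
    by (subst ennreal_mult') (simp_all only: ennreal_2_power, auto)
  also have "\<dots> = 1"
    by (simp add: power_mult_distrib[symmetric] del: power_Suc)
  finally have one: "(\<integral>\<^sup>+ x. ?f x \<partial>rx_noise) \<le> 2" by simp
  have "(\<integral>\<^sup>+ Z. (\<Prod>n<l * j. ?f (Z n)) \<partial>noiseM (l * j)) = (\<Prod>n<l * j. \<integral>\<^sup>+ x. ?f x \<partial>rx_noise)"
    unfolding noiseM_def by (rule P.product_nn_integral_prod) auto
  also have "\<dots> \<le> 2 ^ (l * j)"
    using one by (simp add: power_mono)
  finally have prod: "(\<integral>\<^sup>+ Z. (\<Prod>n<l * j. ?f (Z n)) \<partial>noiseM (l * j)) \<le> 2 ^ (l * j)" .
  have [measurable]: "(\<lambda>Z. \<Prod>n<l * j. ?f (Z n)) \<in> borel_measurable (noiseM (l * j))"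
    by (intro borel_measurable_prod_ennreal) (auto intro!: measurable_compose[OF measurable_noise_use])
  have pt: "(if j \<le> card {n\<in>{..<l * j}. Z n \<in> E} then 1 else 0) \<le> ennreal ((1/2) ^ ((l + 1) * j)) * (\<Prod>n<l * j. ?f (Z n))" for Z
  proof (cases "j \<le> card {n\<in>{..<l * j}. Z n \<in> E}")
    case True
    have "(\<Prod>n<l * j. ?f (Z n)) = ?a ^ card {n\<in>{..<l * j}. Z n \<in> E}"
      by (simp add: prod.If_cases Int_def)
    also have "\<dots> \<ge> ?a ^ j"
      using True by (intro power_increasing one_le_power) auto
    finally have "ennreal ((1/2) ^ ((l + 1) * j)) * ?a ^ j \<le> ennreal ((1/2) ^ ((l + 1) * j)) * (\<Prod>n<l * j. ?f (Z n))"
      by (intro mult_left_mono) auto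
    moreover have "ennreal ((1/2) ^ ((l + 1) * j)) * ?a ^ j = ennreal ((1/2) ^ ((l + 1) * j) * 2 ^ ((l + 1) * j))"
      by (subst ennreal_mult') (simp_all only: ennreal_2_power power_mult[symmetric], auto)
    moreover have "(1/2::real) ^ ((l + 1) * j) * 2 ^ ((l + 1) * j) = 1"
      by (simp add: power_mult_distrib[symmetric])
    ultimately show ?thesis using True by simp
  qed auto
  have "(\<integral>\<^sup>+ Z. (if j \<le> card {n\<in>{..<l * j}. Z n \<in> E} then 1 else 0) \<partial>noiseM (l * j)) \<le>
     (\<integral>\<^sup>+ Z. ennreal ((1/2) ^ ((l + 1) * j)) * (\<Prod>n<l * j. ?f (Z n)) \<partial>noiseM (l * j))"
    by (intro nn_integral_mono pt)
  also have "\<dots> \<le> ennreal ((1/2) ^ ((l + 1) * j)) * 2 ^ (l * j)"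
    by (subst nn_integral_cmult) (auto intro!: mult_left_mono prod)
  also have "\<dots> = ennreal ((1/2) ^ ((l + 1) * j) * 2 ^ (l * j))"
    by (subst ennreal_mult') (simp_all only: ennreal_2_power, auto)
  also have "(1/2::real) ^ ((l + 1) * j) * 2 ^ (l * j) = (1/2) ^ j"
    by (simp add: power_add power_mult_distrib[symmetric] add_mult_distrib)
  finally show ?thesis .
qed

section \<open>Aligned transmission and zero forcing\<close>

definition qam :: "real \<Rightarrow> nat \<Rightarrow> nat \<Rightarrow> complex" where
  "qam \<Delta> q s = Complex (\<Delta> * real (s mod q)) (\<Delta> * real (s div q))"

text \<open>Distinct indices differ in quotient or remainder by \<open>q\<close>, so the points
  differ by at least one grid step in some coordinate.\<close>

lemma qam_separation:
  assumes "0 \<le> \<Delta>" "s \<noteq> s'"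
  shows "\<Delta> \<le> cmod (qam \<Delta> q s - qam \<Delta> q s')"
proof -
  have sep: "\<Delta> \<le> \<bar>\<Delta> * real x - \<Delta> * real y\<bar>" if "x \<noteq> y" for x y :: nat
  proof -
    have "1 \<le> \<bar>real x - real y\<bar>" using that by linarith
    from mult_left_mono[OF this assms(1)] show ?thesis
      using assms(1) by (simp add: right_diff_distrib[symmetric] abs_mult)
  qed
  have "s mod q \<noteq> s' mod q \<or> s div q \<noteq> s' div q"
    using assms(2) by (metis div_mult_mod_eq)
  then show ?thesis
    using sep abs_Re_le_cmod[of "qam \<Delta> q s - qam \<Delta> q s'"] abs_Im_le_cmod[of "qam \<Delta> q s - qam \<Delta> q s'"]
    by (fastforce simp: qam_def intro: order_trans)
qed

lemma qam_bound:
  assumes "0 \<le> \<Delta>" "s < q * q"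
  shows "cmod (qam \<Delta> q s) \<le> 2 * q * \<Delta>"
proof -
  have "0 < q" using assms by (cases q) auto
  then have "s mod q < q" "s div q < q"
    using assms(2) by (auto simp: less_mult_imp_div_less)
  then have "\<Delta> * real (s mod q) \<le> \<Delta> * q" "\<Delta> * real (s div q) \<le> \<Delta> * q"
    using assms(1) by (auto intro!: mult_left_mono)
  moreover have "cmod (qam \<Delta> q s) \<le> \<bar>\<Delta> * real (s mod q)\<bar> + \<bar>\<Delta> * real (s div q)\<bar>"
    unfolding qam_def using cmod_le[of "Complex (\<Delta> * real (s mod q)) (\<Delta> * real (s div q))"] by simp
  ultimately show ?thesis using assms(1) by (simp add: algebra_simps)
qed

text \<open>Four vectors in general position in three-dimensional space; \<open>filt r\<close> annihilates the two
  that interfere at \<open>r\<close>.\<close>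

fun beam :: "rx \<Rightarrow> nat \<Rightarrow> complex" where
  "beam a2 j = (if j = 0 then 1 else 0)" | "beam b2 j = (if j = 0 then 1 else 0)"
| "beam a1 j = (if j = 1 then 1 else 0)" | "beam c1 j = (if j = 1 then 1 else 0)"
| "beam c2 j = (if j = 2 then 1 else 0)" | "beam d2 j = (if j = 2 then 1 else 0)"
| "beam b1 j = 1" | "beam d1 j = 1"

fun filt :: "rx \<Rightarrow> nat \<Rightarrow> complex" where
  "filt a1 j = (if j = 1 then 1 else if j = 2 then - 1 else 0)"
| "filt b1 j = (if j = 2 then 1 else 0)"
| "filt a2 j = (if j = 0 then 1 else 0)"
| "filt c2 j = (if j = 2 then 1 else 0)"
| "filt c1 j = (if j = 1 then 1 else if j = 0 then - 1 else 0)"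
| "filt d1 j = (if j = 0 then 1 else 0)"
| "filt b2 j = (if j = 0 then 1 else if j = 1 then - 1 else 0)"
| "filt d2 j = (if j = 2 then 1 else if j = 1 then - 1 else 0)"

lemma cmod_beam_le: "cmod (beam r j) \<le> 1"
  by (cases r) auto

lemma cmod_filt_le: "cmod (filt r j) \<le> 1"
  by (cases r) auto

text \<open>Each receiver hears four streams. Two of the three unwanted ones share a beam, so one
  dimension remains for the desired stream, and \<open>filt\<close> is scaled to give it gain
  one.\<close>

lemma filt_beam:
  "conn r (owner r') \<Longrightarrow> (\<Sum>j<3. filt r j * beam r' j) = (if r' = r then 1 else 0)"
  by (cases r; cases r') (simp_all add: numeral_3_eq_3)

text \<open>The gains \<open>h\<close> are constant over the three uses, so the filter can be moved
  past them onto the beams, where \<open>filt_beam\<close> leaves the desired stream only.\<close>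

lemma zero_forcing:
  fixes h x
  defines "X \<equiv> \<lambda>t j. \<Sum>r | owner r = t. x r * beam r j"
  shows "(\<Sum>j<3. filt r j * ((\<Sum>t\<in>UNIV. if conn r t then h t * X t j else 0) + z j)) =
     h (owner r) * x r + (\<Sum>j<3. filt r j * z j)"
proof -
  have "(\<Sum>j<3. filt r j * (\<Sum>t\<in>UNIV. if conn r t then h t * X t j else 0)) =
      (\<Sum>t\<in>UNIV. if conn r t then h t * (\<Sum>r' | owner r' = t. x r' * (\<Sum>j<3. filt r j * beam r' j)) else 0)"
  proof -
    have "(\<Sum>j<3. filt r j * (\<Sum>t\<in>UNIV. if conn r t then h t * X t j else 0)) =
       (\<Sum>t\<in>UNIV. \<Sum>j<3. filt r j * (if conn r t then h t * X t j else 0))"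
      by (simp only: sum_distrib_left) (rule sum.swap)
    also have "\<dots> = (\<Sum>t\<in>UNIV. if conn r t then h t * (\<Sum>j<3. \<Sum>r' | owner r' = t. x r' * (filt r j * beam r' j)) else 0)"
      by (intro sum.cong refl) (auto simp: X_def sum_distrib_left mult_ac)
    also have "\<dots> = (\<Sum>t\<in>UNIV. if conn r t then h t * (\<Sum>r' | owner r' = t. x r' * (\<Sum>j<3. filt r j * beam r' j)) else 0)"
      by (subst sum.swap) (simp only: sum_distrib_left)
    finally show ?thesis .
  qed
  also have "\<dots> = (\<Sum>t\<in>UNIV. if t = owner r then h t * x r else 0)"
  proof (rule sum.cong[OF refl])
    fix t
    have "(\<Sum>r' | owner r' = t. x r' * (\<Sum>j<3. filt r j * beam r' j)) = (\<Sum>r' | owner r' = t. if r' = r then x r else 0)"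
      if "conn r t"
      using that by (intro sum.cong refl) (auto simp: filt_beam)
    then show "(if conn r t then h t * (\<Sum>r' | owner r' = t. x r' * (\<Sum>j<3. filt r j * beam r' j)) else 0) =
       (if t = owner r then h t * x r else 0)"
      by (auto simp: sum.delta)
  qed
  also have "\<dots> = h (owner r) * x r" by simp
  finally show ?thesis by (simp add: distrib_left sum.distrib)
qed

section \<open>Outer code, encoder and decoder\<close>

definition min_distance :: "(nat \<Rightarrow> nat \<Rightarrow> nat) \<Rightarrow> nat \<Rightarrow> nat \<Rightarrow> nat \<Rightarrow> bool" where
  "min_distance c m K d \<longleftrightarrow>
     (\<forall>w<m. \<forall>w'<m. w \<noteq> w' \<longrightarrow> d \<le> card {k\<in>{..<K}. c w k \<noteq> c w' k})"

text \<open>The codewords are numbered so that messages are natural numbers below \<open>m\<close>,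
  and the cardinality bound is put in logarithmic form, as needed for rates.\<close>

lemma gilbert_varshamov_code:
  assumes Q: "1 \<le> Q" and d: "1 \<le> d"
  obtains m c where "1 \<le> m" "\<forall>w<m. \<forall>k<K. c w k < (Q::nat)" "min_distance c m K d"
    "real K * ln Q \<le> ln m + real K * ln 2 + real d * ln Q"
proof -
  obtain V where V: "V \<subseteq> {..<K} \<rightarrow>\<^sub>E {..<Q}"
    "\<forall>x\<in>V. \<forall>y\<in>V. x \<noteq> y \<longrightarrow> d \<le> card {k\<in>{..<K}. x k \<noteq> y k}"
    "Q ^ K \<le> card V * (2 ^ K * Q ^ d)"
    by (rule gilbert_varshamov[OF Q d])
  have finV: "finite V"
    by (rule finite_subset[OF V(1)]) (simp add: finite_PiE)
  obtain c where c: "bij_betw c {0..<card V} V"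
    using ex_bij_betw_nat_finite[OF finV] by blast
  have cV: "c w \<in> V" if "w < card V" for w
    using bij_betwE[OF c] that by auto
  have pos: "1 \<le> card V"
    using V(3) Q by (cases "card V") auto
  show thesis
  proof (rule that[of "card V" c])
    show "1 \<le> card V" by (rule pos)
    show "\<forall>w<card V. \<forall>k<K. c w k < Q"
    proof (intro allI impI)
      fix w k assume "w < card V" "k < K"
      then show "c w k < Q"
        using PiE_mem[of "c w" "{..<K}" "\<lambda>_. {..<Q}" k] subsetD[OF V(1) cV[of w]] by simp
    qed
    show "min_distance c (card V) K d"
      unfolding min_distance_def
    proof (intro allI impI)
      fix w w' assume w: "w < card V" "w' < card V" "w \<noteq> w'"
      then have "c w \<noteq> c w'"
        using bij_betw_imp_inj_on[OF c] by (auto simp: inj_on_def)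
      then show "d \<le> card {k \<in> {..<K}. c w k \<noteq> c w' k}"
        using V(2) cV w by blast
    qed
    have "real (Q ^ K) \<le> real (card V * (2 ^ K * Q ^ d))"
      using V(3) by (rule of_nat_mono)
    then have "ln (real (Q ^ K)) \<le> ln (real (card V * (2 ^ K * Q ^ d)))"
      using Q pos by (subst ln_le_cancel_iff) auto
    moreover have "ln (real (Q ^ K)) = K * ln Q"
      using Q by (simp add: ln_realpow)
    moreover have "ln (real (card V * (2 ^ K * Q ^ d))) = ln (card V) + (K * ln 2 + d * ln Q)"
      using Q pos by (simp add: ln_mult ln_realpow)
    ultimately show "real K * ln Q \<le> ln (card V) + real K * ln 2 + real d * ln Q" by simp
  qed
qed

text \<open>One code symbol per stream and coherence block of length three: \<open>n div 3\<close>
  is the block, hence the position in the codeword, and \<open>n mod 3\<close> is the coordinate of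
  the beam. The value is the same for all channel states, so one encoder serves with and without
  CSIT.\<close>

definition bia_encoder :: "real \<Rightarrow> nat \<Rightarrow> (nat \<Rightarrow> nat \<Rightarrow> nat) \<Rightarrow> encoder" where
  "bia_encoder \<Delta> q c t n w G = (\<Sum>r | owner r = t. qam \<Delta> q (c (w r) (n div 3)) * beam r (n mod 3))"

text \<open>The threshold \<open>\<theta>\<close> will be half the minimum distance of the faded constellation.\<close>

definition inconsistent ::
    "real \<Rightarrow> real \<Rightarrow> nat \<Rightarrow> (nat \<Rightarrow> nat \<Rightarrow> nat) \<Rightarrow> rx \<Rightarrow> (nat \<Rightarrow> complex) \<Rightarrow> (nat \<Rightarrow> tx \<Rightarrow> complex) \<Rightarrow> nat \<Rightarrow> nat \<Rightarrow> bool" where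
  "inconsistent \<theta> \<Delta> q c r y h w k \<longleftrightarrow>
     \<theta> \<le> cmod ((\<Sum>j<3. filt r j * y (3 * k + j)) - h (3 * k) (owner r) * qam \<Delta> q (c w k))"

text \<open>Bounded-distance decoding: fewer than \<open>d / 2\<close> blocks may contradict the
  message. Picking the candidate by \<open>LEAST\<close> keeps the decoder measurable.\<close>

definition bia_decoder ::
    "real \<Rightarrow> real \<Rightarrow> nat \<Rightarrow> (nat \<Rightarrow> nat \<Rightarrow> nat) \<Rightarrow> nat \<Rightarrow> nat \<Rightarrow> nat \<Rightarrow> decoder" where
  "bia_decoder \<theta> \<Delta> q c m K d r y h =
     (LEAST w. w < m \<and> 2 * card {k\<in>{..<K}. inconsistent \<theta> \<Delta> q c r y h w k} < d)"

lemma measurable_bia_decoder: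
  "(\<lambda>(y, h). bia_decoder \<theta> \<Delta> q c m K d r y h) \<in> measurable
     (PiM {..<3 * K} (\<lambda>_. borel) \<Otimes>\<^sub>M PiM {..<3 * K} (\<lambda>_. PiM UNIV (\<lambda>_. borel))) (count_space UNIV)"
  (is "_ \<in> measurable ?M _")
proof -
  have y: "(\<lambda>p. fst p n) \<in> borel_measurable ?M" if "n < 3 * K" for n
    by (rule measurable_compose[OF measurable_fst measurable_component_singleton]) (use that in auto)
  have h: "(\<lambda>p. snd p n t) \<in> borel_measurable ?M" if "n < 3 * K" for n t
  proof -
    have "(\<lambda>p. snd p n) \<in> measurable ?M (PiM UNIV (\<lambda>_. borel))"
      by (rule measurable_compose[OF measurable_snd measurable_component_singleton]) (use that in auto)
    then show ?thesis
      by (rule measurable_compose) (rule measurable_component_singleton, simp)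
  qed
  have inc: "Measurable.pred ?M (\<lambda>p. inconsistent \<theta> \<Delta> q c r (fst p) (snd p) w k)" if "k < K" for w k
  proof -
    have [measurable]: "(\<lambda>p. fst p (3 * k + j)) \<in> borel_measurable ?M" if "j \<in> {..<3}" for j
      using that \<open>k < K\<close> by (intro y) auto
    have [measurable]: "(\<lambda>p. snd p (3 * k) (owner r)) \<in> borel_measurable ?M"
      using that by (intro h) auto
    show ?thesis unfolding inconsistent_def by measurable
  qed
  \<comment> \<open>As a finite sum of indicators the cardinality is visibly measurable.\<close>
  have card_eq: "card {k\<in>{..<K}. R k} = (\<Sum>k<K. if R k then 1 else 0)" for R :: "nat \<Rightarrow> bool"
    by (simp add: sum.If_cases Int_def)
  have "(\<lambda>p. card {k\<in>{..<K}. inconsistent \<theta> \<Delta> q c r (fst p) (snd p) w k}) \<in> measurable ?M (count_space UNIV)" for w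
    unfolding card_eq
  proof (rule measurable_sum_nat)
    fix k assume "k \<in> {..<K}"
    then have [measurable]: "Measurable.pred ?M (\<lambda>p. inconsistent \<theta> \<Delta> q c r (fst p) (snd p) w k)"
      by (intro inc) simp
    show "(\<lambda>p. if inconsistent \<theta> \<Delta> q c r (fst p) (snd p) w k then 1 else 0::nat) \<in> measurable ?M (count_space UNIV)"
      by measurable
  qed
  note [measurable] = this
  show ?thesis
    unfolding bia_decoder_def split_beta' by measurable
qed

text \<open>Two codewords with fewer than \<open>d / 2\<close> inconsistent positions each would both be consistent
  at one of the at least \<open>d\<close> positions where they differ.\<close>

lemma bia_decoder_correct:
  assumes c: "min_distance c m K d" and w: "w < m"
    and h: "\<And>k. k < K \<Longrightarrow> hmin \<le> cmod (h (3 * k) (owner r))" and \<Delta>: "0 \<le> \<Delta>" "2 * \<theta> \<le> hmin * \<Delta>" "0 < hmin"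
    and few: "2 * card {k\<in>{..<K}. inconsistent \<theta> \<Delta> q c r y h w k} < d"
  shows "bia_decoder \<theta> \<Delta> q c m K d r y h = w"
proof -
  have unique: "w' = w" if w': "w' < m" and few': "2 * card {k\<in>{..<K}. inconsistent \<theta> \<Delta> q c r y h w' k} < d" for w'
  proof (rule ccontr)
    assume ne: "w' \<noteq> w"
    let ?I = "\<lambda>w. {k\<in>{..<K}. inconsistent \<theta> \<Delta> q c r y h w k}"
    have "card (?I w \<union> ?I w') \<le> card (?I w) + card (?I w')" by (rule card_Un_le)
    also have "\<dots> < d" using few few' by linarith
    also have "d \<le> card {k\<in>{..<K}. c w k \<noteq> c w' k}"
      using c w w' ne unfolding min_distance_def by blast
    finally have "card (?I w \<union> ?I w') < card {k\<in>{..<K}. c w k \<noteq> c w' k}" .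
    moreover have "finite (?I w \<union> ?I w')" by simp
    ultimately have "\<not> {k\<in>{..<K}. c w k \<noteq> c w' k} \<subseteq> ?I w \<union> ?I w'"
      by (meson card_mono leD)
    then obtain k where k: "k < K" "c w k \<noteq> c w' k"
      and "\<not> inconsistent \<theta> \<Delta> q c r y h w k" "\<not> inconsistent \<theta> \<Delta> q c r y h w' k"
      by blast
    then have "cmod ((\<Sum>j<3. filt r j * y (3 * k + j)) - h (3 * k) (owner r) * qam \<Delta> q (c w k)) < \<theta>"
      "cmod ((\<Sum>j<3. filt r j * y (3 * k + j)) - h (3 * k) (owner r) * qam \<Delta> q (c w' k)) < \<theta>"
      by (auto simp: inconsistent_def)
    \<comment> \<open>Both faded symbols lie within \<open>\<theta>\<close> of the same filtered
      observation, but distinct ones are at least \<open>hmin * \<Delta>\<close> apart.\<close>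
    from norm_diff_triangle_less[OF this(1)[unfolded norm_minus_commute[of "sum _ _"]] this(2)]
    have "cmod (h (3 * k) (owner r) * qam \<Delta> q (c w k) - h (3 * k) (owner r) * qam \<Delta> q (c w' k)) < 2 * \<theta>"
      by simp
    moreover have "hmin * \<Delta> \<le> cmod (h (3 * k) (owner r)) * cmod (qam \<Delta> q (c w k) - qam \<Delta> q (c w' k))"
      using h[OF k(1)] qam_separation[OF \<Delta>(1) k(2)] \<Delta> by (intro mult_mono) auto
    ultimately show False
      using \<Delta>(2) by (simp add: right_diff_distrib[symmetric] norm_mult)
  qed
  show ?thesis
    unfolding bia_decoder_def
  proof (rule Least_equality)
    fix w' assume "w' < m \<and> 2 * card {k\<in>{..<K}. inconsistent \<theta> \<Delta> q c r y h w' k} < d"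
    then have "w' = w" by (intro unique) (rule conjunct1, assumption, rule conjunct2, assumption)
    then show "w \<le> w'" by simp
  qed (intro conjI w few)
qed

lemma rxsig_zero_forced:
  "(\<Sum>j<3. filt r j * rxsig 3 (bia_encoder \<Delta> q c) w G Z r (3 * k + j)) =
     G k (r, owner r) * qam \<Delta> q (c (w r) k) + (\<Sum>j<3. filt r j * Z (3 * k + j) r)"
proof -
  have "rxsig 3 (bia_encoder \<Delta> q c) w G Z r (3 * k + j) =
      (\<Sum>t\<in>UNIV. if conn r t then G k (r, t) * (\<Sum>r | owner r = t. qam \<Delta> q (c (w r) k) * beam r j) else 0) + Z (3 * k + j) r"
    if "j < 3" for j
  proof -
    have "(3 * k + j) div 3 = k" "(3 * k + j) mod 3 = j" using that by auto
    then show ?thesis unfolding rxsig_def bia_encoder_def by (simp only:)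
  qed
  then have "(\<Sum>j<3. filt r j * rxsig 3 (bia_encoder \<Delta> q c) w G Z r (3 * k + j)) =
      (\<Sum>j<3. filt r j * ((\<Sum>t\<in>UNIV. if conn r t then G k (r, t) * (\<Sum>r | owner r = t. qam \<Delta> q (c (w r) k) * beam r j) else 0) + Z (3 * k + j) r))"
    by (intro sum.cong refl) simp
  also have "\<dots> = G k (r, owner r) * qam \<Delta> q (c (w r) k) + (\<Sum>j<3. filt r j * Z (3 * k + j) r)"
    by (rule zero_forcing)
  finally show ?thesis .
qed

text \<open>For the transmitted message the residual is the filtered noise of the three uses of
  block \<open>k\<close>. Filter coefficients have modulus at most 1, so reaching
  \<open>3 * \<theta>\<close> requires one noise value of modulus at least
  \<open>\<theta>\<close>.\<close>

lemma inconsistent_imp_large_noise: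
  assumes "k < K" and inc: "inconsistent (3 * \<theta>) \<Delta> q c r (restrict (rxsig 3 (bia_encoder \<Delta> q c) w G Z r) {..<3 * K})
      (csir 3 (3 * K) G r) (w r) k"
  shows "\<exists>n\<in>{..<3 * K}. n div 3 = k \<and> (\<exists>r. \<theta> \<le> cmod (Z n r))"
proof (rule ccontr)
  assume small: "\<not> ?thesis"
  have small': "cmod (Z (3 * k + j) r) < \<theta>" if "j < 3" for j
  proof -
    have "3 * k + j \<in> {..<3 * K}" "(3 * k + j) div 3 = k" using that assms(1) by auto
    then show ?thesis using small by (metis not_le)
  qed
  have "(\<Sum>j<3. filt r j * restrict (rxsig 3 (bia_encoder \<Delta> q c) w G Z r) {..<3 * K} (3 * k + j)) =
     (\<Sum>j<3. filt r j * rxsig 3 (bia_encoder \<Delta> q c) w G Z r (3 * k + j))"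
    using assms(1) by (intro sum.cong refl) auto
  moreover have "csir 3 (3 * K) G r (3 * k) (owner r) = G k (r, owner r)"
    using assms(1) by (simp add: csir_def)
  ultimately have "3 * \<theta> \<le> cmod (\<Sum>j<3. filt r j * Z (3 * k + j) r)"
    using inc unfolding inconsistent_def rxsig_zero_forced by simp
  also have "\<dots> \<le> (\<Sum>j<3. cmod (filt r j * Z (3 * k + j) r))"
    by (rule norm_sum)
  also have "\<dots> \<le> (\<Sum>j<3. cmod (Z (3 * k + j) r))"
    by (intro sum_mono) (simp add: norm_mult mult_left_le_one_le cmod_filt_le)
  also have "\<dots> < (\<Sum>j<(3::nat). \<theta>)"
    by (intro sum_strict_mono) (auto simp: small' lessThan_empty_iff)
  finally show False by simp
qed

lemma card_owned: "card {r. owner r = t} = 2"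
proof -
  have "{r. owner r = t} = (case t of A \<Rightarrow> {a1, a2} | B \<Rightarrow> {b1, b2} | C \<Rightarrow> {c1, c2} | D \<Rightarrow> {d1, d2})"
    by (cases t) (auto elim!: owner.elims)
  then show ?thesis by (cases t) auto
qed

text \<open>A transmitter superposes two streams of amplitude at most
  \<open>2 * q * \<Delta>\<close> each.\<close>

lemma bia_encoder_bound:
  assumes "0 \<le> \<Delta>" and c: "\<And>r. c (w r) (n div 3) < q * q"
  shows "(cmod (bia_encoder \<Delta> q c t n w G))\<^sup>2 \<le> 16 * (q * \<Delta>)\<^sup>2"
proof -
  have "cmod (bia_encoder \<Delta> q c t n w G) \<le> (\<Sum>r | owner r = t. 2 * real q * \<Delta>)"
    unfolding bia_encoder_def
  proof (rule order_trans[OF norm_sum], rule sum_mono)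
    fix r
    have "cmod (qam \<Delta> q (c (w r) (n div 3))) * cmod (beam r (n mod 3)) \<le> (2 * real q * \<Delta>) * 1"
      by (rule mult_mono[OF qam_bound[OF assms(1) c] cmod_beam_le]) (use assms in auto)
    then show "cmod (qam \<Delta> q (c (w r) (n div 3)) * beam r (n mod 3)) \<le> 2 * real q * \<Delta>"
      by (simp add: norm_mult)
  qed
  also have "\<dots> = 4 * (q * \<Delta>)" by (simp add: card_owned)
  finally have "(cmod (bia_encoder \<Delta> q c t n w G))\<^sup>2 \<le> (4 * (q * \<Delta>))\<^sup>2"
    by (intro power_mono) auto
  then show ?thesis by (simp add: power_mult_distrib)
qed

section \<open>Achievable rates\<close>

context fading_channel
begin

text \<open>The spacing \<open>\<Delta>\<close> depends on \<open>L\<close> and the fading but not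
  on \<open>P\<close>: more power only enlarges the constellation. The code has length
  \<open>L * j\<close> and distance \<open>2 * j\<close>, whence the loss \<open>2 / L\<close>;
  \<open>ln 2\<close> is the Gilbert-Varshamov loss, and the division by 3 accounts for the block
  length.\<close>

lemma achievable_bia:
  assumes L: "1 \<le> L"
  obtains \<Delta> where "0 < \<Delta>"
    "\<And>P q csit \<tau>max. 1 \<le> q \<Longrightarrow> 16 * (real q * \<Delta>)\<^sup>2 \<le> P \<Longrightarrow> 3 \<le> \<tau>max \<Longrightarrow>
       achievable \<mu> \<tau>max csit P (\<lambda>_. ((1 - 2 / real L) * ln (real (q * q)) - ln 2) / 3)"
proof -
  \<comment> \<open>The exponent fits \<open>bad_uses_chernoff\<close> with
    \<open>l = 3 * L\<close>, since there will be \<open>3 * L * j\<close> channel uses.\<close>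
  obtain \<theta> where \<theta>: "0 < \<theta>" and tail: "emeasure rx_noise {x. \<exists>r. \<theta> \<le> cmod (x r)} \<le> ennreal ((1/2) ^ (3 * L + 1))"
    using noise_tail[of "(1/2) ^ (3 * L + 1)"] by auto
  let ?E = "{x :: rx \<Rightarrow> complex. \<exists>r. \<theta> \<le> cmod (x r)}"
  have E: "?E \<in> sets rx_noise"
  proof -
    have "{x \<in> space rx_noise. \<exists>r. \<theta> \<le> cmod (x r)} \<in> sets rx_noise" by measurable
    then show ?thesis by (simp add: space_PiM)
  qed
  \<comment> \<open>Makes the least distance \<open>hmin * \<Delta>\<close> of the faded
    constellation twice the threshold \<open>3 * \<theta>\<close>.\<close>
  define \<Delta> where "\<Delta> = 6 * \<theta> / hmin"
  have \<Delta>: "0 < \<Delta>" "2 * (3 * \<theta>) \<le> hmin * \<Delta>"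
    using \<theta> hmin by (simp_all add: \<Delta>_def)
  show thesis
  proof (rule that[OF \<Delta>(1)])
    fix P q csit \<tau>max assume q: "1 \<le> q" and P: "16 * (real q * \<Delta>)\<^sup>2 \<le> P" and \<tau>max: "3 \<le> (\<tau>max :: nat)"
    define \<rho> where "\<rho> = ((1 - 2 / real L) * ln (real (q * q)) - ln 2) / 3"
    have "\<exists>N\<ge>N0. \<exists>M enc dec. 0 < N \<and> valid_code \<mu> 3 csit P N M enc dec \<and>
        (\<forall>r. \<rho> - \<epsilon> \<le> ln (real (M r)) / real N) \<and> errp \<mu> 3 N M enc dec \<le> ennreal \<epsilon>"
      if \<epsilon>: "0 < \<epsilon>" for \<epsilon> N0
    proof -
      obtain j0 where j0: "(1/2::real) ^ j0 < \<epsilon>"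
        using real_arch_pow_inv[OF \<epsilon>, of "1/2"] by auto
      \<comment> \<open>Large enough for the error bound \<open>(1/2) ^ j\<close> and the length
        \<open>N0\<close>; at least 1 to keep distance and length positive.\<close>
      define j where "j = max 1 (max j0 N0)"
      have j: "1 \<le> j" "(1/2::real) ^ j \<le> \<epsilon>" "N0 \<le> j"
      proof -
        have "(1/2::real) ^ j \<le> (1/2) ^ j0" by (intro power_decreasing) (auto simp: j_def)
        then show "(1/2::real) ^ j \<le> \<epsilon>" using j0 by linarith
      qed (auto simp: j_def)
      define K where "K = L * j"
      define N where "N = 3 * K"
      have Nlj: "N = 3 * L * j" by (simp add: N_def K_def)
      have N: "N0 \<le> N" "0 < N"
      proof -
        have "j \<le> L * j" using L by simp
        with j have "N0 \<le> 3 * (L * j)" "0 < 3 * (L * j)" by linarith+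
        then show "N0 \<le> N" "0 < N" by (simp_all only: N_def K_def)
      qed
      have Q: "1 \<le> q * q" "1 \<le> 2 * j" using q j by auto
      obtain m c where m: "1 \<le> m" and cq: "\<forall>w<m. \<forall>k<K. c w k < q * q"
        and c: "min_distance c m K (2 * j)"
        and size: "real K * ln (q * q) \<le> ln m + real K * ln 2 + real (2 * j) * ln (q * q)"
        by (rule gilbert_varshamov_code[OF Q])
      let ?M = "\<lambda>_ :: rx. m"
      let ?enc = "bia_encoder \<Delta> q c"
      let ?dec = "bia_decoder (3 * \<theta>) \<Delta> q c m K (2 * j)"
      interpret G: prob_space "chanM \<mu> N" by (rule prob_space_chanM)
      have "valid_code \<mu> 3 csit P N ?M ?enc ?dec"
        unfolding valid_code_def
      proof (intro conjI allI impI)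
        fix t n and w w' :: "rx \<Rightarrow> nat" and G
        assume "\<forall>r. owner r = t \<longrightarrow> w r = w' r"
        then show "?enc t n w G = ?enc t n w' G"
          unfolding bia_encoder_def by (intro sum.cong) auto
      next
        have "?enc t n w G = ?enc t n w G'" for t n w G G'
          by (simp add: bia_encoder_def)
        moreover have "(\<lambda>G. ?enc t n w G) \<in> borel_measurable (chanM \<mu> N)" for t n w
          by (simp add: bia_encoder_def)
        ultimately show "if csit then
            (\<forall>t n w G G'. (\<forall>k \<le> n div 3. G k = G' k) \<longrightarrow> ?enc t n w G = ?enc t n w G') \<and>
            (\<forall>t n w. (\<lambda>G. ?enc t n w G) \<in> borel_measurable (chanM \<mu> N))
          else (\<forall>t n w G G'. ?enc t n w G = ?enc t n w G')"
          by simp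
      next
        fix r show "(\<lambda>(y, h). ?dec r y h) \<in> measurable
            (PiM {..<N} (\<lambda>_. borel) \<Otimes>\<^sub>M PiM {..<N} (\<lambda>_. PiM UNIV (\<lambda>_. borel))) (count_space UNIV)"
          unfolding N_def by (rule measurable_bia_decoder)
      next
        fix t n assume n: "n < N"
        have "(\<integral>\<^sup>+ G. ennreal ((cmod (?enc t n w G))\<^sup>2) \<partial>chanM \<mu> N) \<le> ennreal P" if w: "w \<in> msgs ?M" for w
        proof -
          have "n div 3 < K" using n by (auto simp: N_def)
          then have "c (w r) (n div 3) < q * q" for r
            using w cq by (simp add: msgs_def)
          then have "(cmod (?enc t n w G))\<^sup>2 \<le> P" for G
            using bia_encoder_bound[of \<Delta> c w n q t G] P \<Delta>(1) by simp
          then have "(\<integral>\<^sup>+ G. ennreal ((cmod (?enc t n w G))\<^sup>2) \<partial>chanM \<mu> N) \<le> (\<integral>\<^sup>+ G. ennreal P \<partial>chanM \<mu> N)"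
            by (intro nn_integral_mono ennreal_leI)
          then show ?thesis by (simp add: G.emeasure_space_1)
        qed
        then have "(\<Sum>w\<in>msgs ?M. \<integral>\<^sup>+ G. ennreal ((cmod (?enc t n w G))\<^sup>2) \<partial>chanM \<mu> N) \<le> (\<Sum>w\<in>msgs ?M. ennreal P)"
          by (rule sum_mono)
        then show "(\<Sum>w\<in>msgs ?M. \<integral>\<^sup>+ G. ennreal ((cmod (?enc t n w G))\<^sup>2) \<partial>chanM \<mu> N) \<le> ennreal P * of_nat (card (msgs ?M))"
          by (simp add: mult.commute)
      qed (rule m)
      moreover have "\<rho> - \<epsilon> \<le> ln (real m) / real N"
      proof -
        have Lj: "0 < real L" "0 < real j" using L j by auto
        have "real N * \<rho> = real K * ln (q * q) - real (2 * j) * ln (q * q) - real K * ln 2"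
          using Lj unfolding N_def K_def \<rho>_def by (simp add: field_simps)
        also have "\<dots> \<le> ln m" using size by simp
        finally have "\<rho> \<le> ln m / N" using N by (simp add: field_simps)
        then show ?thesis using \<epsilon> by simp
      qed
      moreover have "errp \<mu> 3 N ?M ?enc ?dec \<le> ennreal \<epsilon>"
      proof -
        let ?err = "\<lambda>w G Z. if \<exists>r. ?dec r (restrict (rxsig 3 ?enc w G Z r) {..<N}) (csir 3 N G r) \<noteq> w r then 1 else 0 :: ennreal"
        have noise: "?err w G Z \<le> (if j \<le> card {n\<in>{..<3 * L * j}. Z n \<in> ?E} then 1 else 0)"
          if w: "w \<in> msgs ?M" and range: "\<forall>n r t. n < N \<longrightarrow> conn r t \<longrightarrow> hmin \<le> cmod (G n (r, t)) \<and> cmod (G n (r, t)) \<le> hmax"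
          for w G Z
        proof (cases "j \<le> card {n\<in>{..<3 * L * j}. Z n \<in> ?E}")
          case False
          have "?dec r (restrict (rxsig 3 ?enc w G Z r) {..<N}) (csir 3 N G r) = w r" for r
          proof (rule bia_decoder_correct[OF c])
            show "w r < m" using w by (simp add: msgs_def)
            show "hmin \<le> cmod (csir 3 N G r (3 * k) (owner r))" if "k < K" for k
              using that range by (simp add: csir_def N_def)
            let ?I = "{k\<in>{..<K}. inconsistent (3 * \<theta>) \<Delta> q c r (restrict (rxsig 3 ?enc w G Z r) {..<N}) (csir 3 N G r) (w r) k}"
            \<comment> \<open>Each inconsistent block contains a channel use with large noise, so
              fewer than \<open>j\<close> such uses leave fewer than \<open>j\<close> inconsistent
              blocks, half the distance \<open>2 * j\<close>.\<close>
            have "?I \<subseteq> (\<lambda>n. n div 3) ` {n\<in>{..<3 * L * j}. Z n \<in> ?E}"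
            proof
              fix k assume "k \<in> ?I"
              then obtain n where "n \<in> {..<3 * K}" "n div 3 = k" "\<exists>r. \<theta> \<le> cmod (Z n r)"
                using inconsistent_imp_large_noise[of k K \<theta> \<Delta> q c r w G Z] by (auto simp: N_def)
              then show "k \<in> (\<lambda>n. n div 3) ` {n\<in>{..<3 * L * j}. Z n \<in> ?E}"
                by (intro image_eqI[of _ _ n]) (auto simp: K_def)
            qed
            then have "card ?I \<le> card ((\<lambda>n. n div 3) ` {n\<in>{..<3 * L * j}. Z n \<in> ?E})"
              by (intro card_mono) auto
            also have "\<dots> \<le> card {n\<in>{..<3 * L * j}. Z n \<in> ?E}"
              by (intro card_image_le) auto
            finally show "2 * card ?I < 2 * j" using False by linarith
          qed (use \<Delta> hmin in auto)
          then show ?thesis using False by simp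
        qed auto
        have "(\<integral>\<^sup>+ G. \<integral>\<^sup>+ Z. ?err w G Z \<partial>noiseM N \<partial>chanM \<mu> N) \<le> ennreal ((1/2) ^ j)" if w: "w \<in> msgs ?M" for w
        proof -
          have "(\<integral>\<^sup>+ G. \<integral>\<^sup>+ Z. ?err w G Z \<partial>noiseM N \<partial>chanM \<mu> N) \<le>
             (\<integral>\<^sup>+ G. \<integral>\<^sup>+ Z. (if j \<le> card {n\<in>{..<3 * L * j}. Z n \<in> ?E} then 1 else 0) \<partial>noiseM N \<partial>chanM \<mu> N)"
            by (rule nn_integral_mono_AE, rule AE_mp[OF AE_chan_range[of N]], rule AE_I2, rule impI,
                rule nn_integral_mono, rule noise[OF w])
          also have "\<dots> = (\<integral>\<^sup>+ Z. (if j \<le> card {n\<in>{..<3 * L * j}. Z n \<in> ?E} then 1 else 0) \<partial>noiseM (3 * L * j))"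
            by (simp add: G.emeasure_space_1 Nlj[symmetric])
          also have "\<dots> \<le> ennreal ((1/2) ^ j)"
            by (rule bad_uses_chernoff[OF E tail])
          finally show ?thesis .
        qed
        then have "(\<Sum>w\<in>msgs ?M. \<integral>\<^sup>+ G. \<integral>\<^sup>+ Z. ?err w G Z \<partial>noiseM N \<partial>chanM \<mu> N) \<le> (\<Sum>w\<in>msgs ?M. ennreal ((1/2) ^ j))"
          by (rule sum_mono)
        also have "\<dots> \<le> ennreal \<epsilon> * of_nat (card (msgs ?M))"
          unfolding sum_constant mult.commute[of "of_nat _"]
          by (intro mult_right_mono ennreal_leI j(2)) simp
        finally have "errp \<mu> 3 N ?M ?enc ?dec \<le> ennreal \<epsilon> * of_nat (card (msgs ?M)) / of_nat (card (msgs ?M))"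
          unfolding errp_def by (rule divide_right_mono_ennreal)
        also have "\<dots> = ennreal \<epsilon>"
        proof (rule mult_divide_eq_ennreal)
          show "of_nat (card (msgs ?M)) \<noteq> (0 :: ennreal)"
            using card_msgs_pos[of ?M] m by (auto simp: card_gt_0_iff)
        qed simp
        finally show ?thesis .
      qed
      ultimately show ?thesis using N by blast
    qed
    then show "achievable \<mu> \<tau>max csit P (\<lambda>_. ((1 - 2 / real L) * ln (real (q * q)) - ln 2) / 3)"
      unfolding achievable_def \<rho>_def[symmetric] using \<tau>max by (intro bexI[of _ 3]) auto
  qed
qed

end

section \<open>Degrees of freedom\<close>

context fading_channel
begin

text \<open>The achievable tuple \<open>R\<close> makes the set of sum rates nonempty; without it
  the supremum of reals would be unspecified.\<close>

lemma sum_capacity_le: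
  assumes P: "0 \<le> P" and R: "achievable \<mu> \<tau>max csit P R" "\<forall>r. 0 \<le> R r"
  shows "sum_capacity \<mu> \<tau>max csit P \<le> 8 / 3 * (ln (1 + 32 * hmax\<^sup>2 * P) + 25 + 16 * (hmax / hmin)\<^sup>2)"
  unfolding sum_capacity_def by (rule cSup_least) (use R sum_rate_bound[OF _ P] in auto)

lemma sum_capacity_ge:
  assumes P: "0 \<le> P" and R: "achievable \<mu> \<tau>max csit P R" "\<forall>r. 0 \<le> R r"
  shows "(\<Sum>r\<in>UNIV. R r) \<le> sum_capacity \<mu> \<tau>max csit P"
  unfolding sum_capacity_def
proof (rule cSup_upper)
  show "bdd_above {(\<Sum>r\<in>UNIV. R r) | R. (\<forall>r. 0 \<le> R r) \<and> achievable \<mu> \<tau>max csit P R}"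
    by (rule bdd_aboveI[where M="8 / 3 * (ln (1 + 32 * hmax\<^sup>2 * P) + 25 + 16 * (hmax / hmin)\<^sup>2)"])
       (use sum_rate_bound[OF _ P] in auto)
qed (use R in auto)

text \<open>For large \<open>P\<close> the side \<open>q\<close> of the constellation is the largest
  that the power constraint admits, about \<open>sqrt P / (4 * \<Delta>)\<close>, so
  \<open>ln (q * q)\<close> is \<open>ln P\<close> up to a constant.\<close>

lemma achievable_log_rate:
  assumes L: "3 \<le> L" and \<tau>max: "3 \<le> \<tau>max"
  obtains \<beta> where "0 < \<beta>"
    "\<forall>\<^sub>F P in at_top. \<exists>\<rho>. 0 \<le> \<rho> \<and> ((1 - 2 / real L) * (ln P - \<beta>) - ln 2) / 3 \<le> \<rho> \<and>
        achievable \<mu> \<tau>max csit P (\<lambda>_. \<rho>)"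
proof -
  have "1 \<le> L" using L by simp
  then obtain \<Delta> where \<Delta>: "0 < \<Delta>" and ach: "\<And>P q. 1 \<le> q \<Longrightarrow> 16 * (real q * \<Delta>)\<^sup>2 \<le> P \<Longrightarrow>
      achievable \<mu> \<tau>max csit P (\<lambda>_. ((1 - 2 / real L) * ln (real (q * q)) - ln 2) / 3)"
    using achievable_bia[of L thesis] \<tau>max by blast
  define \<gamma> where "\<gamma> = 1 - 2 / real L"
  have \<gamma>: "0 < \<gamma>" using L by (simp add: \<gamma>_def field_simps)
  \<comment> \<open>Rounding down to an integer loses at most a factor 2, so \<open>q\<close> is at
    least \<open>sqrt P / (8 * \<Delta>)\<close>.\<close>
  define \<beta> where "\<beta> = max 1 (2 * ln (8 * \<Delta>))"
  \<comment> \<open>Only nonnegative rates enter \<open>sum_capacity\<close>.\<close>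
  have "eventually (\<lambda>P. \<gamma> * (ln P - \<beta>) - ln 2 \<ge> 0) at_top"
    using \<gamma> by real_asymp
  moreover have "eventually (\<lambda>P. 64 * \<Delta>\<^sup>2 \<le> P) at_top"
    by (rule eventually_ge_at_top)
  ultimately have "\<forall>\<^sub>F P in at_top. \<exists>\<rho>. 0 \<le> \<rho> \<and> (\<gamma> * (ln P - \<beta>) - ln 2) / 3 \<le> \<rho> \<and>
        achievable \<mu> \<tau>max csit P (\<lambda>_. \<rho>)"
  proof eventually_elim
    case (elim P)
    have P: "0 < P" using elim(2) \<Delta> zero_less_power[of \<Delta> 2] by linarith
    \<comment> \<open>The real solution of \<open>16 * (x * \<Delta>)^2 = P\<close>.\<close>
    define x where "x = sqrt P / (4 * \<Delta>)"
    have "8 * \<Delta> \<le> sqrt P"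
      by (rule real_le_rsqrt) (use elim(2) in \<open>simp add: power_mult_distrib\<close>)
    then have x: "2 \<le> x"
      using \<Delta> by (simp add: x_def field_simps)
    define q where "q = nat \<lfloor>x\<rfloor>"
    have q: "real q \<le> x" "x / 2 \<le> real q" "1 \<le> q"
    proof -
      show "real q \<le> x" "x / 2 \<le> real q" using x by (simp_all add: q_def) linarith
      then show "1 \<le> q" using x by linarith
    qed
    have "16 * (real q * \<Delta>)\<^sup>2 \<le> 16 * (x * \<Delta>)\<^sup>2"
      using q \<Delta> by (intro mult_left_mono power_mono mult_right_mono) auto
    also have "16 * (x * \<Delta>)\<^sup>2 = P"
      using \<Delta> P by (simp add: x_def power_divide power_mult_distrib field_simps)
    finally have A: "achievable \<mu> \<tau>max csit P (\<lambda>_. (\<gamma> * ln (real (q * q)) - ln 2) / 3)"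
      unfolding \<gamma>_def by (rule ach[OF q(3)])
    have "ln P - 2 * ln (8 * \<Delta>) = 2 * ln (x / 2)"
      using P \<Delta> by (simp add: x_def ln_div ln_sqrt ln_mult)
    also have "\<dots> \<le> 2 * ln (real q)"
      using q x by simp
    also have "\<dots> = ln (real (q * q))"
      using q by (simp add: ln_mult)
    finally have "ln P - \<beta> \<le> ln (real (q * q))"
      by (simp add: \<beta>_def)
    then have "\<gamma> * (ln P - \<beta>) \<le> \<gamma> * ln (real (q * q))"
      using \<gamma> by (intro mult_left_mono) auto
    then show ?case
      using A elim(1) by (intro exI[of _ "(\<gamma> * ln (real (q * q)) - ln 2) / 3"]) (auto simp: divide_right_mono)
  qed
  moreover have "0 < \<beta>" by (simp add: \<beta>_def)
  ultimately show thesis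
    using that[of \<beta>] by (simp only: \<gamma>_def)
qed

text \<open>The loss \<open>2 / L\<close> survives the limit in \<open>P\<close>, so for the lower
  bound \<open>L\<close> is fixed first, according to the target \<open>a\<close>, and only then
  does \<open>P\<close> grow. The upper bound is the converse divided by
  \<open>ln P\<close>.\<close>

lemma has_DoF_8_3:
  assumes \<tau>max: "3 \<le> \<tau>max"
  shows "has_DoF \<mu> \<tau>max csit (8 / 3)"
  unfolding has_DoF_def
proof (rule order_tendstoI)
  fix a :: real assume a: "a < 8 / 3"
  have "((\<lambda>L. 8 / 3 * (1 - 2 / real L)) \<longlongrightarrow> 8 / 3) sequentially"
    by real_asymp
  then have "eventually (\<lambda>L. a < 8 / 3 * (1 - 2 / real L)) sequentially"
    using a by (rule order_tendstoD)
  then have "eventually (\<lambda>L. 3 \<le> L \<and> a < 8 / 3 * (1 - 2 / real L)) sequentially"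
    using eventually_ge_at_top[of 3] by eventually_elim simp
  then obtain L where L: "3 \<le> L" "a < 8 / 3 * (1 - 2 / real L)"
    using eventually_happens'[OF sequentially_bot] by blast
  obtain \<beta> where ev: "\<forall>\<^sub>F P in at_top. \<exists>\<rho>. 0 \<le> \<rho> \<and> ((1 - 2 / real L) * (ln P - \<beta>) - ln 2) / 3 \<le> \<rho> \<and>
        achievable \<mu> \<tau>max csit P (\<lambda>_. \<rho>)"
    by (rule achievable_log_rate[OF L(1) \<tau>max])
  define \<gamma> where "\<gamma> = 1 - 2 / real L"
  have "((\<lambda>P. 8 / 3 * (\<gamma> * (ln P - \<beta>) - ln 2) / ln P) \<longlongrightarrow> 8 / 3 * \<gamma>) at_top"
    by real_asymp
  then have "eventually (\<lambda>P. a < 8 / 3 * (\<gamma> * (ln P - \<beta>) - ln 2) / ln P) at_top"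
    by (rule order_tendstoD) (use L(2) in \<open>simp add: \<gamma>_def\<close>)
  with ev eventually_gt_at_top[of 1] show "eventually (\<lambda>P. a < sum_capacity \<mu> \<tau>max csit P / ln P) at_top"
  proof eventually_elim
    case (elim P)
    then obtain \<rho> where \<rho>: "0 \<le> \<rho>" "(\<gamma> * (ln P - \<beta>) - ln 2) / 3 \<le> \<rho>" "achievable \<mu> \<tau>max csit P (\<lambda>_. \<rho>)"
      unfolding \<gamma>_def by blast
    have "8 * \<rho> \<le> sum_capacity \<mu> \<tau>max csit P"
      using sum_capacity_ge[OF _ \<rho>(3)] \<rho>(1) elim(2) by (simp add: UNIV_rx)
    then have "8 / 3 * (\<gamma> * (ln P - \<beta>) - ln 2) \<le> sum_capacity \<mu> \<tau>max csit P"
      using \<rho>(2) by simp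
    then have "8 / 3 * (\<gamma> * (ln P - \<beta>) - ln 2) / ln P \<le> sum_capacity \<mu> \<tau>max csit P / ln P"
      using elim(2) by (intro divide_right_mono) auto
    with elim(3) show ?case by (rule less_le_trans)
  qed
next
  fix a :: real assume a: "8 / 3 < a"
  \<comment> \<open>Any \<open>L \<ge> 3\<close> would do: the rate only serves to make the set of
    sum rates nonempty.\<close>
  obtain \<beta> where ev: "\<forall>\<^sub>F P in at_top. \<exists>\<rho>. 0 \<le> \<rho> \<and> ((1 - 2 / real 3) * (ln P - \<beta>) - ln 2) / 3 \<le> \<rho> \<and>
        achievable \<mu> \<tau>max csit P (\<lambda>_. \<rho>)"
    by (rule achievable_log_rate[OF order_refl \<tau>max])
  define c where "c = 32 * hmax\<^sup>2"
  define c' where "c' = 25 + 16 * (hmax / hmin)\<^sup>2"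
  have "0 < c" using hmax by (simp add: c_def)
  then have "((\<lambda>P. 8 / 3 * (ln (1 + c * P) + c') / ln P) \<longlongrightarrow> 8 / 3) at_top"
    by real_asymp
  then have "eventually (\<lambda>P. 8 / 3 * (ln (1 + c * P) + c') / ln P < a) at_top"
    using a by (rule order_tendstoD)
  with ev eventually_gt_at_top[of 1] show "eventually (\<lambda>P. sum_capacity \<mu> \<tau>max csit P / ln P < a) at_top"
  proof eventually_elim
    case (elim P)
    then obtain \<rho> where \<rho>: "0 \<le> \<rho>" "achievable \<mu> \<tau>max csit P (\<lambda>_. \<rho>)" by blast
    then have "sum_capacity \<mu> \<tau>max csit P \<le> 8 / 3 * (ln (1 + c * P) + c')"
      using sum_capacity_le[OF _ \<rho>(2)] elim(2) by (simp add: c_def c'_def add.assoc)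
    then have "sum_capacity \<mu> \<tau>max csit P / ln P \<le> 8 / 3 * (ln (1 + c * P) + c') / ln P"
      using elim(2) by (intro divide_right_mono) auto
    then show ?case using elim(3) by (rule le_less_trans)
  qed
qed

end

theorem theorem5:
  fixes \<tau>max :: nat
  assumes "3 \<le> \<tau>max"
  shows "(\<forall>\<mu> csit. admissible_fading \<mu> \<and> spatially_iid \<mu> \<longrightarrow> has_DoF \<mu> \<tau>max csit (8/3))
       \<and> (\<forall>\<mu> csit. admissible_fading \<mu> \<longrightarrow> has_DoF \<mu> \<tau>max csit (8/3))"
  using admissible_fading_channel fading_channel.has_DoF_8_3[OF _ assms] by blast

end
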